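(* Let $n\ge 2$, let $F$ be a field of characteristic $0$, and let $(A,\cdot,\omega)$ be a simple $n$-Lie Poisson algebra over $F$ with $1\in A$. Let $Z=\{a\in A \mid \omega(a,A,\ldots,A)=0\}$ be the center of the $n$-Lie algebra $(A,\omega)$, and let $A^{[1]}=\omega(A,\ldots,A)$. Then the $n$-Lie algebra $A^{[1]}/(A^{[1]}\cap Z)$ is simple.
   Context: An $n$-Lie algebra over $F$ is a vector space $L$ with an $n$-linear skew-symmetric map $\omega:L^n\to L$ such that $\omega(\omega(x_1,\ldots,x_n),y_2,\ldots,y_n)=\sum_{i=1}^n\omega(x_1,\ldots,x_{i-1},\omega(x_i,y_2,\ldots,y_n),x_{i+1},\ldots,x_n)$ for all $x_i,y_j\in L$. For subspaces $X_1,\ldots,X_n\subseteq L$, $\omega(X_1,\ldots,X_n)$ denotes the linear span of all $\omega(x_1,\ldots,x_n)$ with $x_i\in X_i$. An ideal of the $n$-Lie algebra $L$ is a subspace $I$ with $\omega(I,L,\ldots,L)\subseteq I$. An $n$-Lie algebra is called simple if it has no nontrivial ideals, i.e. no ideals other than $0$ and itself. An $n$-Lie Poisson algebra $(A,\cdot,\omega)$ over $F$ is an associative commutative $F$-algebra $(A,\cdot)$ with an $n$-linear map $\omega$ such that $(A,\omega)$ is an $n$-Lie algebra and $\omega(ab,u_2,\ldots,u_n)=a\,\omega(b,u_2,\ldots,u_n)+\omega(a,u_2,\ldots,u_n)\,b$ for all $a,b,u_2,\ldots,u_n\in A$. An $n$-ary Poisson ideal is an ideal $I$ of the associative commutative algebra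 $A$ with $\omega(I,A,\ldots,A)\subseteq I$. The $n$-Lie Poisson algebra $A$ is simple if it has no nontrivial $n$-ary Poisson ideals (none other than $0$ and $A$). $1$ denotes the identity element of $(A,\cdot)$. $A^{[1]}=\omega(A,\ldots,A)$ is an $n$-Lie algebra under $\omega$, and $A^{[1]}\cap Z$ is an ideal of it; the quotient carries the induced bracket. *)

theory Defs
  imports "HOL-Algebra.Module" "HOL-Algebra.QuotRing" "HOL-Library.NList" "HOL.Hull"
begin

text \<open>
  An \<open>n\<close>-ary bracket takes a list of length \<open>n\<close> of elements of the carrier.  The fields
  \<open>mult\<close> and \<open>one\<close>, inherited from \<open>ring\<close> via \<open>module\<close>, play no role for \<open>n\<close>-Lie algebras;
  they are only used for Poisson algebras.
\<close>

record ('a, 'b) n_lie = "('a, 'b) module" +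
  bracket :: "'b list \<Rightarrow> 'b"  (\<open>\<omega>\<index>\<close>)

locale n_lie_algebra = field F + module F L
  for n :: nat
    and F :: "('a, 'c) ring_scheme" (structure)
    and L :: "('a, 'b, 'd) n_lie_scheme" (structure) +
  assumes bracket_closed:
      "xs \<in> nlists n (carrier L) \<Longrightarrow> \<omega>\<^bsub>L\<^esub> xs \<in> carrier L"
    and bracket_add:
      "\<lbrakk>xs \<in> nlists n (carrier L); i < n; x \<in> carrier L; y \<in> carrier L\<rbrakk> \<Longrightarrow>
        \<omega>\<^bsub>L\<^esub> (xs[i := x \<oplus>\<^bsub>L\<^esub> y]) = \<omega>\<^bsub>L\<^esub> (xs[i := x]) \<oplus>\<^bsub>L\<^esub> \<omega>\<^bsub>L\<^esub> (xs[i := y])"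
    and bracket_smult:
      "\<lbrakk>xs \<in> nlists n (carrier L); i < n; c \<in> carrier F; x \<in> carrier L\<rbrakk> \<Longrightarrow>
        \<omega>\<^bsub>L\<^esub> (xs[i := c \<odot>\<^bsub>L\<^esub> x]) = c \<odot>\<^bsub>L\<^esub> \<omega>\<^bsub>L\<^esub> (xs[i := x])"
    and bracket_skew:
      "\<lbrakk>xs \<in> nlists n (carrier L); i < n; j < n; i \<noteq> j\<rbrakk> \<Longrightarrow>
        \<omega>\<^bsub>L\<^esub> (xs[i := xs ! j, j := xs ! i]) = \<ominus>\<^bsub>L\<^esub> \<omega>\<^bsub>L\<^esub> xs"
    and bracket_identity:
      "\<lbrakk>xs \<in> nlists n (carrier L); ys \<in> nlists (n - 1) (carrier L)\<rbrakk> \<Longrightarrow>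
        \<omega>\<^bsub>L\<^esub> (\<omega>\<^bsub>L\<^esub> xs # ys) = (\<Oplus>\<^bsub>L\<^esub>i\<in>{..<n}. \<omega>\<^bsub>L\<^esub> (xs[i := \<omega>\<^bsub>L\<^esub> (xs ! i # ys)]))"

text \<open>
  The subspace \<open>\<omega>(X\<^sub>1, \<dots>, X\<^sub>n)\<close>: the smallest subspace containing all brackets \<open>\<omega>(x\<^sub>1, \<dots>, x\<^sub>n)\<close>
  with \<open>x\<^sub>i \<in> X\<^sub>i\<close>, for a list \<open>Xs = [X\<^sub>1, \<dots>, X\<^sub>n]\<close>.
\<close>

definition bracket_span ::
    "('a, 'c) ring_scheme \<Rightarrow> ('a, 'b, 'd) n_lie_scheme \<Rightarrow> 'b set list \<Rightarrow> 'b set"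
  where "bracket_span F L Xs = (\<lambda>H. submodule H F L) hull (bracket L ` listset Xs)"

definition n_lie_ideal ::
    "nat \<Rightarrow> ('a, 'c) ring_scheme \<Rightarrow> ('a, 'b, 'd) n_lie_scheme \<Rightarrow> 'b set \<Rightarrow> bool"
  where "n_lie_ideal n F L I \<longleftrightarrow>
    submodule I F L \<and> bracket_span F L (I # replicate (n - 1) (carrier L)) \<subseteq> I"

locale simple_n_lie_algebra = n_lie_algebra +
  assumes simple: "n_lie_ideal n F L I \<Longrightarrow> I = {\<zero>\<^bsub>L\<^esub>} \<or> I = carrier L"

definition n_lie_center :: "nat \<Rightarrow> ('a, 'b, 'd) n_lie_scheme \<Rightarrow> 'b set"
  where "n_lie_center n L =
    {a \<in> carrier L. \<forall>ys \<in> nlists (n - 1) (carrier L). \<omega>\<^bsub>L\<^esub> (a # ys) = \<zero>\<^bsub>L\<^esub>}"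

definition n_lie_derived ::
    "nat \<Rightarrow> ('a, 'c) ring_scheme \<Rightarrow> ('a, 'b, 'd) n_lie_scheme \<Rightarrow> ('a, 'b, 'd) n_lie_scheme"
  where "n_lie_derived n F L = L\<lparr>carrier := bracket_span F L (replicate n (carrier L))\<rparr>"

text \<open>
  The quotient \<open>L/I\<close> on the cosets of \<open>I\<close>.  As in \<^const>\<open>rcoset_mult\<close>, an operation on
  cosets is the union of the cosets of its values on representatives; when \<open>I\<close> is an ideal these
  cosets coincide.
\<close>

definition n_lie_quotient :: "('a, 'b, 'd) n_lie_scheme \<Rightarrow> 'b set \<Rightarrow> ('a, 'b set) n_lie"
  where "n_lie_quotient L I =
    \<lparr>carrier = a_rcosets\<^bsub>L\<^esub> I, mult = undefined, one = undefined,
     zero = I, add = set_add L,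
     smult = (\<lambda>c X. \<Union>x\<in>X. I +>\<^bsub>L\<^esub> (c \<odot>\<^bsub>L\<^esub> x)),
     bracket = (\<lambda>Xs. \<Union>xs\<in>listset Xs. I +>\<^bsub>L\<^esub> \<omega>\<^bsub>L\<^esub> xs)\<rparr>"

text \<open>
  The locale \<^locale>\<open>algebra\<close> is that of associative commutative algebras \<open>A\<close> with an identity
  element \<open>1 \<in> A\<close> (\<open>1 = 0\<close> is not excluded).
\<close>

locale unital_n_lie_poisson_algebra = n_lie_algebra n F A + algebra F A
  for n :: nat
    and F :: "('a, 'c) ring_scheme" (structure)
    and A :: "('a, 'b, 'd) n_lie_scheme" (structure) +
  assumes leibniz:
      "\<lbrakk>a \<in> carrier A; b \<in> carrier A; us \<in> nlists (n - 1) (carrier A)\<rbrakk> \<Longrightarrow>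
        \<omega>\<^bsub>A\<^esub> ((a \<otimes>\<^bsub>A\<^esub> b) # us) = a \<otimes>\<^bsub>A\<^esub> \<omega>\<^bsub>A\<^esub> (b # us) \<oplus>\<^bsub>A\<^esub> \<omega>\<^bsub>A\<^esub> (a # us) \<otimes>\<^bsub>A\<^esub> b"

definition n_lie_poisson_ideal ::
    "nat \<Rightarrow> ('a, 'c) ring_scheme \<Rightarrow> ('a, 'b, 'd) n_lie_scheme \<Rightarrow> 'b set \<Rightarrow> bool"
  where "n_lie_poisson_ideal n F A I \<longleftrightarrow>
    ideal I A \<and> submodule I F A \<and> bracket_span F A (I # replicate (n - 1) (carrier A)) \<subseteq> I"

locale simple_unital_n_lie_poisson_algebra = unital_n_lie_poisson_algebra +
  assumes simple: "n_lie_poisson_ideal n F A I \<Longrightarrow> I = {\<zero>\<^bsub>A\<^esub>} \<or> I = carrier A"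

definition char_zero :: "('a, 'c) ring_scheme \<Rightarrow> bool"
  where "char_zero R \<longleftrightarrow> (\<forall>k::nat. k > 0 \<longrightarrow> [k] \<cdot>\<^bsub>R\<^esub> \<one>\<^bsub>R\<^esub> \<noteq> \<zero>\<^bsub>R\<^esub>)"

end

(*
  Write B = A^[1], and let U be an ideal of the n-Lie algebra B; to show: U is central in A or U = B.
  This is clear if B is central, so assume it is not.  Every map a |-> w(.., a, ..) is a
  derivation of A, so in characteristic 0 the nilradical is a Poisson ideal and A is reduced.  Let
  T = {t. w(t, A, .., A) <= U}, which is a subalgebra of A containing w(U, U, B, .., B).

  If T is central, then D = w(u, -, c) with u in U and c in B^(n-2) satisfies D^3 B = 0; expanding
  powers of D on products b w(b, y, c) and using reducedness gives D B = 0, hence u is central.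

  If T is not central, then some f = w(t, x, c) with t, x in T and c in B^(n-2) is nonzero, because
  otherwise D = w(t, -, c) would satisfy D^2 B = 0.  The square f^2 lies in K, the largest ideal of A
  inside T.  As K is stable under brackets with B, it is a Poisson ideal: a derivation mapping B into
  an ideal of A maps A into it, since the elements w(b, a_2, .., a_n) generate the unit ideal.
  Hence K = T = A and U = B.
*)
theory Submission
  imports Defs
begin

section \<open>Derivations and nilpotent elements\<close>

locale derivation = cring R for R (structure) +
  fixes D
  assumes D_closed [simp, intro]: "a \<in> carrier R \<Longrightarrow> D a \<in> carrier R"
    and D_add: "\<lbrakk>a \<in> carrier R; b \<in> carrier R\<rbrakk> \<Longrightarrow> D (a \<oplus> b) = D a \<oplus> D b"
    and D_mult: "\<lbrakk>a \<in> carrier R; b \<in> carrier R\<rbrakk> \<Longrightarrow> D (a \<otimes> b) = a \<otimes> D b \<oplus> D a \<otimes> b"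
begin

lemma D_zero [simp]: "D \<zero> = \<zero>"
proof -
  have "D \<zero> \<oplus> D \<zero> = D \<zero>"
    using D_add[of \<zero> \<zero>] by simp
  then show ?thesis
    by (simp add: add.r_cancel_one)
qed

lemma D_minus: "a \<in> carrier R \<Longrightarrow> D (\<ominus> a) = \<ominus> D a"
  by (metis D_add D_closed D_zero a_inv_closed l_neg minus_equality)

lemma D_pow:
  "a \<in> carrier R \<Longrightarrow> D (a [^] Suc j) = [Suc j] \<cdot> (a [^] j \<otimes> D a)"
proof (induction j)
  case 0
  then show ?case
    using D_mult[of \<one> \<one>] by (simp add: D_mult add.r_cancel_one)
next
  case (Suc j)
  have "D (a [^] Suc (Suc j)) = a [^] Suc j \<otimes> D a \<oplus> D (a [^] Suc j) \<otimes> a"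
    using Suc.prems D_mult[of "a [^] Suc j" a] by simp
  also have "D (a [^] Suc j) \<otimes> a = [Suc j] \<cdot> (a [^] Suc j \<otimes> D a)"
    proof -
    have "D (a [^] Suc j) \<otimes> a = [Suc j] \<cdot> (a [^] j \<otimes> D a \<otimes> a)"
      using Suc by (simp add: add_pow_ldistr del: add.nat_pow_Suc nat_pow_Suc)
    also have "a [^] j \<otimes> D a \<otimes> a = a [^] Suc j \<otimes> D a"
      using Suc.prems by (simp add: m_ac)
    finally show ?thesis .
  qed
  finally show ?case
    using Suc.prems by (simp add: a_comm)
qed

text \<open>Put \<open>z = D a [^] e\<close>, apply \<open>D\<close> to
  \<open>a [^] Suc j \<otimes> z = \<zero>\<close> and multiply by \<open>z\<close>: the term with
  \<open>D z\<close> keeps the factor \<open>a [^] Suc j \<otimes> z\<close> and vanishes.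
  Cancelling the integer leaves \<open>a [^] j \<otimes> D a [^] Suc (e + e) = \<zero>\<close>, so
  the exponent of \<open>a\<close> drops until only a power of \<open>D a\<close> remains. For
  \<open>e = 0\<close> this says that \<open>D\<close> preserves nilpotency.\<close>

lemma mult_D_pow_nilpotent:
  assumes torsion_free: "\<And>k a. \<lbrakk>a \<in> carrier R; [Suc k] \<cdot> a = \<zero>\<rbrakk> \<Longrightarrow> a = \<zero>"
    and a: "a \<in> carrier R" and "a [^] (j :: nat) \<otimes> D a [^] (e :: nat) = \<zero>"
  shows "\<exists>k :: nat. D a [^] k = \<zero>"
  using assms(3)
proof (induction j arbitrary: e)
  case 0
  then show ?case using a by auto
next
  case (Suc j)
  let ?z = "D a [^] e"
  have z: "?z \<in> carrier R" using a by simp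
  have D_mult_z: "D (x \<otimes> ?z) \<otimes> ?z = x \<otimes> ?z \<otimes> D ?z \<oplus> D x \<otimes> (?z \<otimes> ?z)"
    if x: "x \<in> carrier R" for x
  proof -
    have "(x \<otimes> D ?z \<oplus> D x \<otimes> ?z) \<otimes> ?z = x \<otimes> ?z \<otimes> D ?z \<oplus> D x \<otimes> (?z \<otimes> ?z)"
      using x z D_closed[OF x] D_closed[OF z] by algebra
    then show ?thesis
      using x z by (simp only: D_mult)
  qed
  have "\<zero> = D (a [^] Suc j \<otimes> ?z) \<otimes> ?z"
    unfolding Suc.prems using z by simp
  also have "\<dots> = D (a [^] Suc j) \<otimes> (?z \<otimes> ?z)"
    unfolding D_mult_z[OF nat_pow_closed[OF a]] unfolding Suc.prems
    using z a by (simp only: l_null l_zero m_closed nat_pow_closed D_closed)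
  also have "\<dots> = [Suc j] \<cdot> (a [^] j \<otimes> D a \<otimes> (?z \<otimes> ?z))"
    unfolding D_pow[OF a] by (rule add_pow_ldistr) (intro m_closed nat_pow_closed D_closed a)+
  finally have "[Suc j] \<cdot> (a [^] j \<otimes> D a \<otimes> (?z \<otimes> ?z)) = \<zero>"
    by (rule sym)
  then have "a [^] j \<otimes> D a \<otimes> (?z \<otimes> ?z) = \<zero>"
    by (rule torsion_free[rotated]) (intro m_closed nat_pow_closed D_closed a)
  moreover have "a [^] j \<otimes> D a \<otimes> (?z \<otimes> ?z) = a [^] j \<otimes> D a [^] Suc (e + e)"
    unfolding nat_pow_Suc nat_pow_mult[OF D_closed[OF a], symmetric] using a by (simp add: m_ac)
  ultimately have "a [^] j \<otimes> D a [^] Suc (e + e) = \<zero>"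
    by (simp only:)
  then show ?case
    by (rule Suc.IH)
qed

text \<open>Expanding \<open>D (D (E (v \<otimes> a))) = \<zero>\<close> gives \<open>D v \<otimes> D (E a) = \<zero>\<close> for all \<open>a\<close>; replacing
  \<open>a\<close> by \<open>v \<otimes> t\<close> then gives \<open>D v \<otimes> D v \<otimes> E t = \<zero>\<close>.\<close>

lemma D_cube_eq_zero:
  assumes torsion_free: "\<And>k a. \<lbrakk>a \<in> carrier R; [Suc k] \<cdot> a = \<zero>\<rbrakk> \<Longrightarrow> a = \<zero>"
    and "derivation R E" and v: "v \<in> carrier R" and t: "t \<in> carrier R"
    and DDv: "D (D v) = \<zero>" and Ev: "E v = \<zero>" and Et: "E t = \<ominus> D v"
    and DDE: "\<And>a. a \<in> carrier R \<Longrightarrow> D (D (E a)) = \<zero>"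
  shows "D v [^] (3 :: nat) = \<zero>"
proof -
  interpret E: derivation R E by fact
  have 1: "D v \<otimes> D (E a) = \<zero>" if a: "a \<in> carrier R" for a
  proof -
    have "\<zero> = D (D (v \<otimes> E a))"
      using DDE[of "v \<otimes> a"] v a Ev by (simp add: E.D_mult)
    also have "\<dots> = [Suc 1] \<cdot> (D v \<otimes> D (E a))"
      using v a DDv DDE[OF a] by (simp add: D_mult D_add)
    finally show ?thesis
      using torsion_free[of "D v \<otimes> D (E a)" 1] v a by (metis D_closed E.D_closed m_closed)
  qed
  have "\<zero> = D v \<otimes> D (v \<otimes> E t)"
    using 1[of "v \<otimes> t"] v t Ev by (simp add: E.D_mult)
  also have "\<dots> = v \<otimes> (D v \<otimes> D (E t)) \<oplus> D v \<otimes> D v \<otimes> E t"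
    using v t by (simp add: D_mult r_distr m_ac)
  also have "\<dots> = D v \<otimes> D v \<otimes> E t"
    unfolding 1[OF t] using v t by simp
  also have "\<dots> = \<ominus> (D v [^] (3 :: nat))"
    using v by (simp add: Et numeral_3_eq_3 r_minus)
  finally show ?thesis
    using v by (metis D_closed minus_minus minus_zero nat_pow_closed)
qed

text \<open>The argument of \<open>D_cube_eq_zero\<close> one order higher, with
  \<open>d = D (D v)\<close>. Expanding \<open>D (D (D (v \<otimes> E a))) = \<zero>\<close> and
  cancelling 3 gives fact \<open>1\<close>; applying \<open>D\<close> to it gives \<open>2\<close>,
  and multiplying it by \<open>d\<close> then gives \<open>3\<close>. Taking
  \<open>v \<otimes> t\<close> for \<open>a\<close> in \<open>2\<close> yields
  \<open>d \<otimes> d \<otimes> d \<otimes> E t = \<zero>\<close>, and since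
  \<open>D d = \<zero>\<close> a last application of \<open>D\<close> turns
  \<open>E t = \<ominus> D v\<close> into \<open>\<ominus> d\<close>.\<close>

lemma D_D_pow4_eq_zero:
  assumes torsion_free: "\<And>k a. \<lbrakk>a \<in> carrier R; [Suc k] \<cdot> a = \<zero>\<rbrakk> \<Longrightarrow> a = \<zero>"
    and "derivation R E" and v: "v \<in> carrier R" and t: "t \<in> carrier R"
    and D3v: "D (D (D v)) = \<zero>" and Ev: "E v = \<zero>" and Et: "E t = \<ominus> D v"
    and D3E: "\<And>a. a \<in> carrier R \<Longrightarrow> D (D (D (E a))) = \<zero>"
  shows "D (D v) [^] (4 :: nat) = \<zero>"
proof -
  interpret E: derivation R E by fact
  let ?d = "D (D v)"
  have 1: "?d \<otimes> D (E a) \<oplus> D v \<otimes> D (D (E a)) = \<zero>" if a: "a \<in> carrier R" for a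
  proof -
    have "\<zero> = D (D (D (v \<otimes> E a)))"
      using D3E[of "v \<otimes> a"] v a Ev by (simp add: E.D_mult)
    also have "\<dots> = [Suc 2] \<cdot> (?d \<otimes> D (E a) \<oplus> D v \<otimes> D (D (E a)))"
      using v a D3v D3E[OF a] by (simp add: D_mult D_add a_ac numeral_2_eq_2)
    finally show ?thesis
      using torsion_free[of "?d \<otimes> D (E a) \<oplus> D v \<otimes> D (D (E a))" 2] v a
      by (metis D_closed E.D_closed m_closed a_closed)
  qed
  have 2: "?d \<otimes> D (D (E a)) = \<zero>" if a: "a \<in> carrier R" for a
  proof -
    have "\<zero> = D (?d \<otimes> D (E a) \<oplus> D v \<otimes> D (D (E a)))"
      using 1[OF a] by simp
    also have "\<dots> = [Suc 1] \<cdot> (?d \<otimes> D (D (E a)))"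
      using v a D3v D3E[OF a] by (simp add: D_mult D_add)
    finally show ?thesis
      using torsion_free[of "?d \<otimes> D (D (E a))" 1] v a by (metis D_closed E.D_closed m_closed)
  qed
  have 3: "?d \<otimes> ?d \<otimes> D (E a) = \<zero>" if a: "a \<in> carrier R" for a
  proof -
    have "\<zero> = ?d \<otimes> (?d \<otimes> D (E a) \<oplus> D v \<otimes> D (D (E a)))"
      using 1[OF a] v by simp
    also have "\<dots> = ?d \<otimes> ?d \<otimes> D (E a) \<oplus> D v \<otimes> (?d \<otimes> D (D (E a)))"
      using v a by (simp add: r_distr m_ac)
    finally show ?thesis
      using v a by (simp add: 2)
  qed
  have "\<zero> = ?d \<otimes> (?d \<otimes> D (D (v \<otimes> E t)))"
    using 2[of "v \<otimes> t"] v t Ev by (simp add: E.D_mult)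
  also have "\<dots> = ?d \<otimes> (v \<otimes> (?d \<otimes> D (D (E t)))) \<oplus> (D v \<otimes> (?d \<otimes> ?d \<otimes> D (E t)) \<oplus> D v \<otimes> (?d \<otimes> ?d \<otimes> D (E t))) \<oplus> ?d \<otimes> ?d \<otimes> ?d \<otimes> E t"
  proof -
    have "?d \<otimes> (?d \<otimes> (v \<otimes> x \<oplus> D v \<otimes> y \<oplus> (D v \<otimes> y \<oplus> ?d \<otimes> z)))
        = ?d \<otimes> (v \<otimes> (?d \<otimes> x)) \<oplus> (D v \<otimes> (?d \<otimes> ?d \<otimes> y) \<oplus> D v \<otimes> (?d \<otimes> ?d \<otimes> y)) \<oplus> ?d \<otimes> ?d \<otimes> ?d \<otimes> z"
      if "x \<in> carrier R" "y \<in> carrier R" "z \<in> carrier R" for x y z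
      using that v D_closed[OF v] D_closed[OF D_closed[OF v]] by algebra
    from this[of "D (D (E t))" "D (E t)" "E t"] show ?thesis
      using v t by (simp add: D_mult D_add)
  qed
  also have "\<dots> = ?d \<otimes> ?d \<otimes> ?d \<otimes> E t"
    unfolding 2[OF t] 3[OF t] using v t by simp
  finally have d: "?d \<otimes> ?d \<otimes> ?d \<otimes> E t = \<zero>"
    by (rule sym)
  have "\<zero> = D (?d \<otimes> ?d \<otimes> ?d \<otimes> E t)"
    unfolding d by simp
  also have "\<dots> = \<ominus> (?d [^] (4 :: nat))"
    using v t D3v by (simp add: D_mult Et D_minus r_minus eval_nat_numeral)
  finally show ?thesis
    using v by (metis D_closed minus_minus minus_zero nat_pow_closed)
qed

end

text \<open>Instead of a binomial expansion, the induction carries a factor \<open>z\<close> killed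
  by \<open>a [^] j\<close> and by \<open>b [^] k\<close>. Splitting off one factor
  \<open>a \<oplus> b\<close> replaces \<open>z\<close> by \<open>a \<otimes> z\<close> and
  \<open>b \<otimes> z\<close>, for which one of the two exponents is smaller by one.\<close>

lemma (in cring) nilpotent_add:
  assumes "a \<in> carrier R" "b \<in> carrier R" "a [^] (j :: nat) = \<zero>" "b [^] (k :: nat) = \<zero>"
  shows "(a \<oplus> b) [^] (j + k) = \<zero>"
proof -
  have "(a \<oplus> b) [^] (j + k) \<otimes> z = \<zero>"
    if "z \<in> carrier R" "a [^] j \<otimes> z = \<zero>" "b [^] k \<otimes> z = \<zero>" for z
    using that
  proof (induction "j + k" arbitrary: j k z)
    case 0
    then show ?case by simp
  next
    case (Suc m)
    have *: "(a \<oplus> b) [^] m \<otimes> (a \<otimes> z) = \<zero>"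
    proof (cases j)
      case 0
      then have "z = \<zero>" using Suc.prems by simp
      then show ?thesis using assms by simp
    next
      case (Suc j')
      have "b [^] k \<otimes> (a \<otimes> z) = a \<otimes> (b [^] k \<otimes> z)"
        using assms Suc.prems by (simp add: m_ac)
      then show ?thesis
        using Suc.hyps(1)[of j' k "a \<otimes> z"] Suc Suc.hyps(2) Suc.prems assms by (simp add: m_assoc)
    qed
    have **: "(a \<oplus> b) [^] m \<otimes> (b \<otimes> z) = \<zero>"
    proof (cases k)
      case 0
      then have "z = \<zero>" using Suc.prems by simp
      then show ?thesis using assms by simp
    next
      case (Suc k')
      have "a [^] j \<otimes> (b \<otimes> z) = b \<otimes> (a [^] j \<otimes> z)"
        using assms Suc.prems by (simp add: m_ac)
      then show ?thesis
        using Suc.hyps(1)[of j k' "b \<otimes> z"] Suc Suc.hyps(2) Suc.prems assms by (simp add: m_assoc)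
    qed
    have "(a \<oplus> b) [^] (j + k) \<otimes> z = (a \<oplus> b) [^] m \<otimes> (a \<otimes> z) \<oplus> (a \<oplus> b) [^] m \<otimes> (b \<otimes> z)"
      using assms Suc.prems unfolding Suc.hyps(2)[symmetric]
      by (simp add: m_assoc l_distr r_distr)
    then show ?case using * ** by simp
  qed
  from this[of \<one>] show ?thesis using assms by simp
qed

lemma (in cring) nilradical_ideal: "ideal {a \<in> carrier R. \<exists>k :: nat. a [^] k = \<zero>} R"
proof (rule idealI)
  show "ring R" ..
  have mult: "x \<otimes> a \<in> {a \<in> carrier R. \<exists>k :: nat. a [^] k = \<zero>}"
    if a: "a \<in> {a \<in> carrier R. \<exists>k :: nat. a [^] k = \<zero>}" and x: "x \<in> carrier R" for a x
  proof -
    obtain k :: nat where "a \<in> carrier R" "a [^] k = \<zero>"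
      using a by blast
    then have "(x \<otimes> a) [^] k = \<zero>"
      using x by (simp add: nat_pow_distrib)
    then show ?thesis
      using a x by blast
  qed
  then show "\<And>a x. \<lbrakk>a \<in> {a \<in> carrier R. \<exists>k :: nat. a [^] k = \<zero>}; x \<in> carrier R\<rbrakk>
      \<Longrightarrow> x \<otimes> a \<in> {a \<in> carrier R. \<exists>k :: nat. a [^] k = \<zero>}"
    and "\<And>a x. \<lbrakk>a \<in> {a \<in> carrier R. \<exists>k :: nat. a [^] k = \<zero>}; x \<in> carrier R\<rbrakk>
      \<Longrightarrow> a \<otimes> x \<in> {a \<in> carrier R. \<exists>k :: nat. a [^] k = \<zero>}"
    by (simp_all add: m_comm)
  show "subgroup {a \<in> carrier R. \<exists>k :: nat. a [^] k = \<zero>} (add_monoid R)"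
  proof (rule add.subgroupI)
    have "\<zero> [^] (1 :: nat) = \<zero>" by simp
    then show "{a \<in> carrier R. \<exists>k :: nat. a [^] k = \<zero>} \<noteq> {}" by blast
  next
    fix a assume "a \<in> {a \<in> carrier R. \<exists>k :: nat. a [^] k = \<zero>}"
    then show "\<ominus> a \<in> {a \<in> carrier R. \<exists>k :: nat. a [^] k = \<zero>}"
      using mult[of a "\<ominus> \<one>"] by (auto simp: l_minus)
  qed (auto dest: nilpotent_add)
qed

section \<open>Subalgebras and quotients of n-Lie algebras\<close>

\<comment> \<open>As conditional rewrite rules with extra variables these make the simplifier loop.\<close>
declare nlistsE_length [simp del] nlistsE_set [simp del] nlists_Cons_Suc [rule del]

section \<open>Lists with entries in prescribed sets\<close>

lemma mem_listset_iff: "xs \<in> listset Xs \<longleftrightarrow> list_all2 (\<in>) xs Xs"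
  by (induction Xs arbitrary: xs) (auto simp: set_Cons_def list_all2_Cons2)

lemma listset_replicate: "listset (replicate n X) = nlists n X"
  by (induction n) (auto simp: set_Cons_def nlists_Suc)

lemma nlists_image: "nlists n (f ` A) = map f ` nlists n A"
proof -
  have nlists_eq: "nlists n B = lists B \<inter> {xs. length xs = n}" for n and B :: "'e set"
    by (simp add: nlists_def lists_eq_set Int_def conj_commute)
  show ?thesis
    unfolding nlists_eq lists_image by (auto simp: image_iff)
qed

lemma Cons_in_nlists_iff: "x # ys \<in> nlists n X \<longleftrightarrow> 0 < n \<and> x \<in> X \<and> ys \<in> nlists (n - 1) X"
  by (cases n) (auto simp: nlists_def)

section \<open>Sums and hulls of submodules\<close>

context module
begin

lemma submodule_finsum:
  assumes "submodule H R M" and "\<And>i. i \<in> I \<Longrightarrow> f i \<in> H"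
  shows "(\<Oplus>\<^bsub>M\<^esub>i\<in>I. f i) \<in> H"
proof -
  have "f \<in> I \<rightarrow> carrier M"
    using assms submoduleE(1) by blast
  then show ?thesis
    using assms(2)
  proof (induction I rule: infinite_finite_induct)
    case (insert i I)
    then show ?case
      using submoduleE(5)[OF assms(1)] by (simp add: Pi_def)
  qed (use submoduleE(1,2,5,6)[OF assms(1)] subgroup.one_closed[OF submodule.axioms(1)[OF assms(1)]]
      in simp_all)
qed

lemma submodule_zero: "submodule H R M \<Longrightarrow> \<zero>\<^bsub>M\<^esub> \<in> H"
  using submodule_finsum[of H "{}"] by simp

lemma submodule_minus_iff:
  assumes "submodule H R M" "x \<in> carrier M"
  shows "\<ominus>\<^bsub>M\<^esub> x \<in> H \<longleftrightarrow> x \<in> H"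
  using submoduleE(6)[OF assms(1)] assms(2) by (metis M.minus_minus)

lemma submodule_add_iff:
  assumes "submodule H R M" "x \<in> H" "y \<in> carrier M"
  shows "x \<oplus>\<^bsub>M\<^esub> y \<in> H \<longleftrightarrow> y \<in> H"
proof
  assume "x \<oplus>\<^bsub>M\<^esub> y \<in> H"
  then have "\<ominus>\<^bsub>M\<^esub> x \<oplus>\<^bsub>M\<^esub> (x \<oplus>\<^bsub>M\<^esub> y) \<in> H"
    using assms submoduleE(5,6) by metis
  moreover have "x \<in> carrier M"
    using submoduleE(1)[OF assms(1)] assms(2) by blast
  ultimately show "y \<in> H"
    using assms(3) by (simp add: M.r_neg1)
qed (rule submoduleE(5)[OF assms(1,2)])

text \<open>The hull is an intersection of submodules. Since \<open>X \<subseteq> carrier M\<close>,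
  the carrier is one of them, which bounds the intersection.\<close>

lemma submodule_hull:
  assumes "X \<subseteq> carrier M"
  shows "submodule ((\<lambda>H. submodule H R M) hull X) R M"
proof (rule submoduleI)
  show "(\<lambda>H. submodule H R M) hull X \<subseteq> carrier M"
    using assms carrier_is_submodule by (intro hull_minimal)
qed (auto simp: hull_def submodule_zero submoduleE(4,5,6))

end

section \<open>Brackets and subspaces of an n-Lie algebra\<close>

context n_lie_algebra
begin

lemma bracket_span_subset_iff:
  assumes "submodule H F L"
  shows "bracket_span F L Xs \<subseteq> H \<longleftrightarrow> (\<forall>xs \<in> listset Xs. \<omega>\<^bsub>L\<^esub> xs \<in> H)"
  unfolding bracket_span_def using subset_hull[of "\<lambda>H. submodule H F L", OF assms] by auto

lemma bracket_span_Cons_subset_iff: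
  assumes "submodule H F L"
  shows "bracket_span F L (I # replicate m X) \<subseteq> H \<longleftrightarrow> (\<forall>x \<in> I. \<forall>ys \<in> nlists m X. \<omega>\<^bsub>L\<^esub> (x # ys) \<in> H)"
  unfolding bracket_span_subset_iff[OF assms] by (auto simp: set_Cons_def listset_replicate)

lemma n_lie_ideal_iff:
  "n_lie_ideal n F L I \<longleftrightarrow>
    submodule I F L \<and> (\<forall>x \<in> I. \<forall>ys \<in> nlists (n - 1) (carrier L). \<omega>\<^bsub>L\<^esub> (x # ys) \<in> I)"
  unfolding n_lie_ideal_def by (simp add: bracket_span_Cons_subset_iff cong: conj_cong)

text \<open>A transposition moves slot \<open>i\<close> to the head and changes only the sign, to
  which a subspace is insensitive.\<close>

lemma bracket_slot:
  assumes I: "submodule I F L"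
    and Cons: "\<And>x ys. \<lbrakk>x \<in> I; ys \<in> nlists (n - 1) (carrier L)\<rbrakk> \<Longrightarrow> \<omega>\<^bsub>L\<^esub> (x # ys) \<in> I"
    and xs: "xs \<in> nlists n (carrier L)" and i: "i < n" and "xs ! i \<in> I"
  shows "\<omega>\<^bsub>L\<^esub> xs \<in> I"
proof (cases "i = 0")
  case True
  moreover obtain x ys where "xs = x # ys"
    using xs i by (cases xs) (auto simp: nlists_def)
  ultimately show ?thesis
    using Cons[of x ys] xs \<open>xs ! i \<in> I\<close> by (simp add: Cons_in_nlists_iff)
next
  case False
  let ?ys = "xs[0 := xs ! i, i := xs ! 0]"
  have ys: "?ys \<in> nlists n (carrier L)"
    using xs i by (intro nlists_update_in_list nlistsE_nth_in) auto
  obtain z zs where zs: "?ys = z # zs"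
    using ys i by (cases ?ys) (auto simp: nlists_def)
  moreover have "?ys ! 0 = xs ! i"
    using nlistsE_length[OF xs] i False by simp
  ultimately have "\<omega>\<^bsub>L\<^esub> ?ys \<in> I"
    using Cons[of z zs] ys \<open>xs ! i \<in> I\<close> by (simp add: Cons_in_nlists_iff)
  then show ?thesis
    using bracket_skew[OF xs _ i, of 0] False i submodule_minus_iff[OF I bracket_closed[OF xs]] by simp
qed

lemma bracket_swap2:
  assumes "2 \<le> n" "x \<in> carrier L" "y \<in> carrier L" "zs \<in> nlists (n - 2) (carrier L)"
  shows "\<omega>\<^bsub>L\<^esub> (y # x # zs) = \<ominus>\<^bsub>L\<^esub> \<omega>\<^bsub>L\<^esub> (x # y # zs)"
  using bracket_skew[of "x # y # zs" 0 1] assms by (auto simp: nlists_def)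

lemma bracket_add_slot:
  assumes "xs \<in> nlists n (carrier L)" "i < n" "x \<in> carrier L"
  shows "\<omega>\<^bsub>L\<^esub> (xs[i := x \<oplus>\<^bsub>L\<^esub> xs ! i]) = \<omega>\<^bsub>L\<^esub> (xs[i := x]) \<oplus>\<^bsub>L\<^esub> \<omega>\<^bsub>L\<^esub> xs"
  using bracket_add[OF assms nlistsE_nth_in[OF assms(1,2)]] by simp

lemma n_lie_subalgebra:
  assumes H: "submodule H F L" and closed: "\<And>xs. xs \<in> nlists n H \<Longrightarrow> \<omega>\<^bsub>L\<^esub> xs \<in> H" and n: "0 < n"
  shows "n_lie_algebra n F (L\<lparr>carrier := H\<rparr>)"
proof -
  interpret H: module F "L\<lparr>carrier := H\<rparr>"
    by (rule submodule.submodule_is_module[OF H]) (rule module_axioms)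
  have HL: "H \<subseteq> carrier L"
    using submoduleE(1)[OF H] .
  have nH: "nlists m H \<subseteq> nlists m (carrier L)" for m
    by (rule nlists_mono) (rule HL)
  \<comment> \<open>Both \<open>a_inv\<close> and \<open>finsum\<close> are defined through the
    carrier, so after restriction to \<open>H\<close> they have to be compared with those of
    \<open>L\<close> on arguments from \<open>H\<close>.\<close>
  have minus: "a_inv (L\<lparr>carrier := H\<rparr>) x = \<ominus>\<^bsub>L\<^esub> x" if "x \<in> H" for x
  proof -
    have "\<ominus>\<^bsub>L\<^esub> x \<oplus>\<^bsub>L\<lparr>carrier := H\<rparr>\<^esub> x = \<zero>\<^bsub>L\<lparr>carrier := H\<rparr>\<^esub>"
      using that HL by (auto simp: M.l_neg)
    then show ?thesis
      using that submoduleE(6)[OF H that] by (intro H.minus_equality) auto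
  qed
  have sum: "finsum (L\<lparr>carrier := H\<rparr>) f I = finsum L f I" if "f \<in> I \<rightarrow> H" for f :: "nat \<Rightarrow> _" and I
    using that
  proof (induction I rule: infinite_finite_induct)
    case (insert i I)
    then have "f \<in> I \<rightarrow> carrier L" "f i \<in> carrier L"
      using HL by auto
    then show ?case
      using insert by (simp add: Pi_def)
  qed (simp_all add: H.finsum_infinite M.finsum_infinite)
  show ?thesis
  proof unfold_locales
    fix xs i j assume "xs \<in> nlists n (carrier (L\<lparr>carrier := H\<rparr>))" "i < n" "j < n" "i \<noteq> j"
    then show "\<omega>\<^bsub>L\<lparr>carrier := H\<rparr>\<^esub> (xs[i := xs ! j, j := xs ! i]) = \<ominus>\<^bsub>L\<lparr>carrier := H\<rparr>\<^esub> \<omega>\<^bsub>L\<lparr>carrier := H\<rparr>\<^esub> xs"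
      using bracket_skew[of xs i j] nH closed[of xs] minus by auto
  next
    fix xs ys assume xs: "xs \<in> nlists n (carrier (L\<lparr>carrier := H\<rparr>))"
      and ys: "ys \<in> nlists (n - 1) (carrier (L\<lparr>carrier := H\<rparr>))"
    have "\<omega>\<^bsub>L\<^esub> (xs[i := \<omega>\<^bsub>L\<^esub> (xs ! i # ys)]) \<in> H" if "i < n" for i
      using xs ys that by (intro closed nlists_update_in_list Cons_in_nlists_iff[THEN iffD2] conjI nlistsE_nth_in) (simp_all add: n)
    then have "(\<lambda>i. \<omega>\<^bsub>L\<^esub> (xs[i := \<omega>\<^bsub>L\<^esub> (xs ! i # ys)])) \<in> {..<n} \<rightarrow> H"
      by auto
    then show "\<omega>\<^bsub>L\<lparr>carrier := H\<rparr>\<^esub> (\<omega>\<^bsub>L\<lparr>carrier := H\<rparr>\<^esub> xs # ys)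
        = (\<Oplus>\<^bsub>L\<lparr>carrier := H\<rparr>\<^esub>i\<in>{..<n}. \<omega>\<^bsub>L\<lparr>carrier := H\<rparr>\<^esub> (xs[i := \<omega>\<^bsub>L\<lparr>carrier := H\<rparr>\<^esub> (xs ! i # ys)]))"
      using bracket_identity[of xs ys] xs ys nH by (auto simp: sum)
  qed (use closed bracket_add bracket_smult nH HL in \<open>auto simp: subset_iff\<close>)
qed

end

section \<open>The quotient by an ideal\<close>

locale n_lie_algebra_ideal = n_lie_algebra n F L
  for n :: nat
    and F :: "('a, 'c) ring_scheme" (structure)
    and L :: "('a, 'b, 'd) n_lie_scheme" (structure) +
  fixes I
  assumes n_pos: "0 < n" and ideal: "n_lie_ideal n F L I"
begin

abbreviation proj :: "'b \<Rightarrow> 'b set" where "proj x \<equiv> I +>\<^bsub>L\<^esub> x"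
abbreviation Q where "Q \<equiv> n_lie_quotient L I"

lemma submodule_I: "submodule I F L"
  using ideal n_lie_ideal_iff by simp

lemma bracket_in_I: "\<lbrakk>xs \<in> nlists n (carrier L); i < n; xs ! i \<in> I\<rbrakk> \<Longrightarrow> \<omega>\<^bsub>L\<^esub> xs \<in> I"
  using bracket_slot[OF submodule_I] ideal n_lie_ideal_iff by blast

sublocale I: abelian_subgroup I L
  using submodule.axioms(1)[OF submodule_I] M.abelian_group_axioms
  by (intro abelian_subgroupI3 additive_subgroupI)

lemma proj_eq_iff:
  assumes "x \<in> carrier L" "y \<in> carrier L"
  shows "proj x = proj y \<longleftrightarrow> x \<oplus>\<^bsub>L\<^esub> \<ominus>\<^bsub>L\<^esub> y \<in> I"
  using assms I.a_rcos_module[of y x] I.a_repr_independence'[of x y] I.a_rcos_self[of x] by auto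

lemma proj_eqI:
  assumes "h \<in> I" "y \<in> carrier L"
  shows "proj (h \<oplus>\<^bsub>L\<^esub> y) = proj y"
  using assms I.a_Hcarr[OF assms(1)] by (subst proj_eq_iff) (simp_all add: M.a_assoc M.r_neg)

lemma mem_proj_iff:
  "x \<in> carrier L \<Longrightarrow> y \<in> proj x \<longleftrightarrow> (\<exists>h \<in> I. y = h \<oplus>\<^bsub>L\<^esub> x)"
  by (auto simp: a_r_coset_def')

lemma carrier_quotient: "carrier Q = proj ` carrier L"
  by (auto simp: n_lie_quotient_def A_RCOSETS_def')

lemma proj_zero: "proj \<zero>\<^bsub>L\<^esub> = \<zero>\<^bsub>Q\<^esub>"
  using I.a_rcos_const[of "\<zero>\<^bsub>L\<^esub>"] by (simp add: n_lie_quotient_def)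

lemma proj_eq_zero_iff: "x \<in> carrier L \<Longrightarrow> proj x = \<zero>\<^bsub>Q\<^esub> \<longleftrightarrow> x \<in> I"
  using I.a_rcos_const[of x] I.a_rcos_self[of x] by (auto simp: n_lie_quotient_def)

lemma proj_add:
  "\<lbrakk>x \<in> carrier L; y \<in> carrier L\<rbrakk> \<Longrightarrow> proj x \<oplus>\<^bsub>Q\<^esub> proj y = proj (x \<oplus>\<^bsub>L\<^esub> y)"
  by (simp add: n_lie_quotient_def I.a_rcos_sum)

lemma proj_smult:
  assumes "c \<in> carrier F" "x \<in> carrier L"
  shows "c \<odot>\<^bsub>Q\<^esub> proj x = proj (c \<odot>\<^bsub>L\<^esub> x)"
proof -
  have "proj (c \<odot>\<^bsub>L\<^esub> y) = proj (c \<odot>\<^bsub>L\<^esub> x)" if "y \<in> proj x" for y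
  proof -
    obtain h where h: "h \<in> I" "y = h \<oplus>\<^bsub>L\<^esub> x"
      using \<open>y \<in> proj x\<close> assms(2) mem_proj_iff by blast
    then have "c \<odot>\<^bsub>L\<^esub> y = c \<odot>\<^bsub>L\<^esub> h \<oplus>\<^bsub>L\<^esub> c \<odot>\<^bsub>L\<^esub> x" and "c \<odot>\<^bsub>L\<^esub> h \<in> I"
      using assms submoduleE(4)[OF submodule_I] by (simp_all add: smult_r_distr)
    then show ?thesis
      using proj_eqI assms by simp
  qed
  then have "(\<Union>y\<in>proj x. proj (c \<odot>\<^bsub>L\<^esub> y)) = (\<Union>y\<in>proj x. proj (c \<odot>\<^bsub>L\<^esub> x))"
    by (rule SUP_cong[OF refl])
  \<comment> \<open>A union of copies of one set equals that set only over a nonempty index set, so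
    a representative is exhibited.\<close>
  moreover have "x \<in> proj x"
    using I.a_rcos_self assms(2) .
  ultimately show ?thesis
    by (simp add: n_lie_quotient_def UN_constant ex_in_conv[symmetric] split: if_splits) blast
qed

text \<open>The entries are exchanged one at a time: \<open>zs k\<close> takes its first
  \<open>k\<close> entries from \<open>xs\<close> and the others from \<open>ys\<close>.
  Neighbouring lists differ in one slot by some \<open>h \<in> I\<close>, and the bracket with
  \<open>h\<close> in that slot lies in \<open>I\<close>.\<close>

lemma proj_bracket_cong:
  assumes xs: "xs \<in> nlists n (carrier L)" and ys: "ys \<in> nlists n (carrier L)"
    and eq: "map proj xs = map proj ys"
  shows "proj (\<omega>\<^bsub>L\<^esub> xs) = proj (\<omega>\<^bsub>L\<^esub> ys)"
proof -
  define zs where "zs k = take k xs @ drop k ys" for k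
  have len: "length xs = n" "length ys = n"
    using xs ys by (simp_all add: nlistsE_length)
  have zs: "zs k \<in> nlists n (carrier L)" for k
    using nlistsE_set[OF xs] nlistsE_set[OF ys] len set_take_subset[of k xs] set_drop_subset[of k ys]
    unfolding zs_def by (intro nlistsI) auto
  have "proj (\<omega>\<^bsub>L\<^esub> (zs k)) = proj (\<omega>\<^bsub>L\<^esub> ys)" if "k \<le> n" for k
    using that
  proof (induction k)
    case 0
    then show ?case by (simp add: zs_def)
  next
    case (Suc k)
    then have k: "k < n" by simp
    have closed: "xs ! k \<in> carrier L" "ys ! k \<in> carrier L"
      using xs ys k by (auto intro: nlistsE_nth_in)
    have "proj (xs ! k) = proj (ys ! k)"
      using eq k len by (metis nth_map)
    then have "xs ! k \<in> proj (ys ! k)"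
      using I.a_rcos_self[OF closed(1)] by simp
    then obtain h where h: "h \<in> I" "xs ! k = h \<oplus>\<^bsub>L\<^esub> ys ! k"
      using closed mem_proj_iff by blast
    have nth: "zs k ! k = ys ! k"
      using k len by (simp add: zs_def nth_append)
    have "zs (Suc k) = (zs k)[k := xs ! k]"
      using k len by (intro nth_equalityI) (auto simp: zs_def nth_append nth_list_update)
    also have "\<dots> = (zs k)[k := h \<oplus>\<^bsub>L\<^esub> zs k ! k]"
      using h nth by simp
    finally have "\<omega>\<^bsub>L\<^esub> (zs (Suc k)) = \<omega>\<^bsub>L\<^esub> ((zs k)[k := h]) \<oplus>\<^bsub>L\<^esub> \<omega>\<^bsub>L\<^esub> (zs k)"
      using bracket_add_slot[OF zs[of k] k, of h] h by simp
    moreover have "\<omega>\<^bsub>L\<^esub> ((zs k)[k := h]) \<in> I"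
      using h zs[of k] k by (intro bracket_in_I[of _ k]) (simp_all add: nlistsE_length)
    ultimately show ?case
      using Suc bracket_closed[OF zs[of k]] proj_eqI by simp
  qed
  from this[of n] show ?thesis
    using len by (simp add: zs_def)
qed

text \<open>Any two lists of representatives have congruent brackets, so the union defining the
  quotient bracket is a single coset; its index set contains \<open>xs\<close>.\<close>

lemma proj_bracket:
  assumes xs: "xs \<in> nlists n (carrier L)"
  shows "\<omega>\<^bsub>Q\<^esub> (map proj xs) = proj (\<omega>\<^bsub>L\<^esub> xs)"
proof -
  have "proj (\<omega>\<^bsub>L\<^esub> ys) = proj (\<omega>\<^bsub>L\<^esub> xs)" if "ys \<in> listset (map proj xs)" for ys
  proof (rule proj_bracket_cong)
    have ys: "length ys = n" "\<And>i. i < n \<Longrightarrow> ys ! i \<in> proj (xs ! i)"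
      using that nlistsE_length[OF xs] by (auto simp: mem_listset_iff list_all2_conv_all_nth)
    moreover have closed: "xs ! i \<in> carrier L" if "i < n" for i
      using xs that by (rule nlistsE_nth_in)
    ultimately have ys_closed: "ys ! i \<in> carrier L" if "i < n" for i
      using that I.a_elemrcos_carrier by blast
    then show "ys \<in> nlists n (carrier L)"
      using ys(1) by (auto intro!: nlistsI simp: set_conv_nth)
    have "proj (ys ! i) = proj (xs ! i)" if "i < n" for i
      using I.a_repr_independence'[OF ys(2) closed] that by simp
    then show "map proj ys = map proj xs"
      using ys(1) nlistsE_length[OF xs] by (intro nth_equalityI) auto
  qed fact
  then have "(\<Union>ys\<in>listset (map proj xs). proj (\<omega>\<^bsub>L\<^esub> ys)) = (\<Union>ys\<in>listset (map proj xs). proj (\<omega>\<^bsub>L\<^esub> xs))"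
    by (rule SUP_cong[OF refl])
  moreover have "xs \<in> listset (map proj xs)"
    using I.a_rcos_self nlistsE_set[OF xs]
    by (auto simp: mem_listset_iff list_all2_conv_all_nth subset_iff)
  ultimately show ?thesis
    by (simp add: n_lie_quotient_def UN_constant ex_in_conv[symmetric] split: if_splits) blast
qed

lemma nlists_quotient:
  assumes "Xs \<in> nlists m (carrier Q)"
  obtains xs where "xs \<in> nlists m (carrier L)" "Xs = map proj xs"
  using assms unfolding carrier_quotient nlists_image by blast

lemma quotient_module: "module F Q"
proof (rule moduleI)
  show "cring F" ..
  show "abelian_group Q"
  proof (rule abelian_groupI)
    fix X assume "X \<in> carrier Q"
    then obtain x where x: "x \<in> carrier L" "X = proj x"
      unfolding carrier_quotient by blast
    then have "proj (\<ominus>\<^bsub>L\<^esub> x) \<oplus>\<^bsub>Q\<^esub> X = \<zero>\<^bsub>Q\<^esub>"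
      by (simp add: proj_add proj_zero M.l_neg)
    then show "\<exists>Y \<in> carrier Q. Y \<oplus>\<^bsub>Q\<^esub> X = \<zero>\<^bsub>Q\<^esub>"
      using x unfolding carrier_quotient by blast
  qed (auto simp: carrier_quotient proj_add proj_zero[symmetric] M.a_ac)
qed (auto simp: carrier_quotient proj_add proj_smult smult_l_distr smult_r_distr smult_assoc1)

sublocale Q: module F Q
  by (rule quotient_module)

lemma proj_minus:
  assumes "x \<in> carrier L"
  shows "\<ominus>\<^bsub>Q\<^esub> proj x = proj (\<ominus>\<^bsub>L\<^esub> x)"
  using assms
  by (intro Q.minus_equality) (simp_all add: proj_add proj_zero M.l_neg carrier_quotient)

lemma proj_finsum:
  assumes "finite J" "f \<in> J \<rightarrow> carrier L"
  shows "(\<Oplus>\<^bsub>Q\<^esub>j\<in>J. proj (f j)) = proj (\<Oplus>\<^bsub>L\<^esub>j\<in>J. f j)"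
  using assms
proof (induction J rule: finite_induct)
  case (insert j J)
  have "(\<lambda>j. proj (f j)) \<in> J \<rightarrow> carrier Q" "proj (f j) \<in> carrier Q" "f \<in> J \<rightarrow> carrier L" "f j \<in> carrier L"
    using insert.prems by (auto simp: carrier_quotient)
  then show ?case
    using insert by (simp add: proj_add)
qed (simp add: proj_zero)

lemma quotient_n_lie_algebra: "n_lie_algebra n F Q"
proof unfold_locales
  fix Xs assume "Xs \<in> nlists n (carrier Q)"
  then obtain xs where xs: "xs \<in> nlists n (carrier L)" "Xs = map proj xs"
    by (rule nlists_quotient)
  then show "\<omega>\<^bsub>Q\<^esub> Xs \<in> carrier Q"
    by (simp add: proj_bracket carrier_quotient bracket_closed)
  fix i assume i: "i < n"
  {
    fix X Y assume "X \<in> carrier Q" "Y \<in> carrier Q"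
    then obtain x y where xy: "x \<in> carrier L" "X = proj x" "y \<in> carrier L" "Y = proj y"
      unfolding carrier_quotient by blast
    then show "\<omega>\<^bsub>Q\<^esub> (Xs[i := X \<oplus>\<^bsub>Q\<^esub> Y]) = \<omega>\<^bsub>Q\<^esub> (Xs[i := X]) \<oplus>\<^bsub>Q\<^esub> \<omega>\<^bsub>Q\<^esub> (Xs[i := Y])"
      using xs i bracket_closed
      by (simp add: proj_add map_update[symmetric] proj_bracket bracket_add)
  next
    fix c X assume "c \<in> carrier F" "X \<in> carrier Q"
    moreover then obtain x where x: "x \<in> carrier L" "X = proj x"
      unfolding carrier_quotient by blast
    ultimately show "\<omega>\<^bsub>Q\<^esub> (Xs[i := c \<odot>\<^bsub>Q\<^esub> X]) = c \<odot>\<^bsub>Q\<^esub> \<omega>\<^bsub>Q\<^esub> (Xs[i := X])"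
      using xs i bracket_closed
      by (simp add: proj_smult map_update[symmetric] proj_bracket bracket_smult)
  next
    fix j assume "j < n" "i \<noteq> j"
    then show "\<omega>\<^bsub>Q\<^esub> (Xs[i := Xs ! j, j := Xs ! i]) = \<ominus>\<^bsub>Q\<^esub> \<omega>\<^bsub>Q\<^esub> Xs"
      using xs i bracket_closed nlistsE_length[OF xs(1)]
      by (simp add: map_update[symmetric] proj_bracket bracket_skew proj_minus nlistsE_nth_in)
  }
next
  fix Xs Ys assume "Xs \<in> nlists n (carrier Q)" "Ys \<in> nlists (n - 1) (carrier Q)"
  then obtain xs ys where xs: "xs \<in> nlists n (carrier L)" "Xs = map proj xs"
    and ys: "ys \<in> nlists (n - 1) (carrier L)" "Ys = map proj ys"
    by (metis nlists_quotient)
  have Cons: "x # ys \<in> nlists n (carrier L)" if "x \<in> carrier L" for x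
    using that ys(1) n_pos by (simp add: Cons_in_nlists_iff)
  then have 1: "\<omega>\<^bsub>Q\<^esub> (proj x # Ys) = proj (\<omega>\<^bsub>L\<^esub> (x # ys))" if "x \<in> carrier L" for x
    using proj_bracket[of "x # ys"] that ys by simp
  have 2: "xs[i := \<omega>\<^bsub>L\<^esub> (xs ! i # ys)] \<in> nlists n (carrier L)" if "i < n" for i
    using xs(1) that by (intro nlists_update_in_list bracket_closed Cons nlistsE_nth_in)
  have "\<omega>\<^bsub>Q\<^esub> (\<omega>\<^bsub>Q\<^esub> Xs # Ys) = proj (\<omega>\<^bsub>L\<^esub> (\<omega>\<^bsub>L\<^esub> xs # ys))"
    using xs bracket_closed[OF xs(1)] by (simp add: proj_bracket 1)
  also have "\<dots> = proj (\<Oplus>\<^bsub>L\<^esub>i\<in>{..<n}. \<omega>\<^bsub>L\<^esub> (xs[i := \<omega>\<^bsub>L\<^esub> (xs ! i # ys)]))"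
    by (simp add: bracket_identity[OF xs(1) ys(1)])
  also have "\<dots> = (\<Oplus>\<^bsub>Q\<^esub>i\<in>{..<n}. proj (\<omega>\<^bsub>L\<^esub> (xs[i := \<omega>\<^bsub>L\<^esub> (xs ! i # ys)])))"
    using 2 bracket_closed by (intro proj_finsum[symmetric]) auto
  also have "\<dots> = (\<Oplus>\<^bsub>Q\<^esub>i\<in>{..<n}. \<omega>\<^bsub>Q\<^esub> (Xs[i := \<omega>\<^bsub>Q\<^esub> (Xs ! i # Ys)]))"
  proof (rule Q.finsum_cong')
    have eq: "proj (\<omega>\<^bsub>L\<^esub> (xs[i := \<omega>\<^bsub>L\<^esub> (xs ! i # ys)])) = \<omega>\<^bsub>Q\<^esub> (Xs[i := \<omega>\<^bsub>Q\<^esub> (Xs ! i # Ys)])"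
      if i: "i < n" for i
    proof -
      have "Xs[i := \<omega>\<^bsub>Q\<^esub> (Xs ! i # Ys)] = map proj (xs[i := \<omega>\<^bsub>L\<^esub> (xs ! i # ys)])"
        using i xs nlistsE_length[OF xs(1)] nlistsE_nth_in[OF xs(1) i] by (simp add: map_update 1)
      then show ?thesis
        using proj_bracket[OF 2[OF i]] by simp
    qed
    then show "\<And>i. i \<in> {..<n} \<Longrightarrow>
        proj (\<omega>\<^bsub>L\<^esub> (xs[i := \<omega>\<^bsub>L\<^esub> (xs ! i # ys)])) = \<omega>\<^bsub>Q\<^esub> (Xs[i := \<omega>\<^bsub>Q\<^esub> (Xs ! i # Ys)])"
      by simp
    show "(\<lambda>i. \<omega>\<^bsub>Q\<^esub> (Xs[i := \<omega>\<^bsub>Q\<^esub> (Xs ! i # Ys)])) \<in> {..<n} \<rightarrow> carrier Q"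
      using 2 bracket_closed by (auto simp: eq[symmetric] carrier_quotient)
  qed simp
  finally show "\<omega>\<^bsub>Q\<^esub> (\<omega>\<^bsub>Q\<^esub> Xs # Ys) = (\<Oplus>\<^bsub>Q\<^esub>i\<in>{..<n}. \<omega>\<^bsub>Q\<^esub> (Xs[i := \<omega>\<^bsub>Q\<^esub> (Xs ! i # Ys)]))" .
qed

text \<open>One half of the ideal correspondence: it turns a question about ideals of
  \<open>Q\<close> into one about ideals of \<open>L\<close>.\<close>

lemma quotient_ideal_preimage:
  assumes "n_lie_ideal n F Q J"
  shows "n_lie_ideal n F L {x \<in> carrier L. proj x \<in> J}"
proof -
  interpret QA: n_lie_algebra n F Q
    by (rule quotient_n_lie_algebra)
  have J: "submodule J F Q"
    and J_bracket: "\<And>X Ys. \<lbrakk>X \<in> J; Ys \<in> nlists (n - 1) (carrier Q)\<rbrakk> \<Longrightarrow> \<omega>\<^bsub>Q\<^esub> (X # Ys) \<in> J"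
    using assms QA.n_lie_ideal_iff by auto
  have "submodule {x \<in> carrier L. proj x \<in> J} F L"
    using Q.submodule_zero[OF J] Q.submoduleE(4,5,6)[OF J]
    by (intro submoduleI) (auto simp: proj_zero proj_minus[symmetric] proj_add[symmetric] proj_smult[symmetric])
  moreover have "\<omega>\<^bsub>L\<^esub> (x # ys) \<in> {x \<in> carrier L. proj x \<in> J}"
    if x: "x \<in> {x \<in> carrier L. proj x \<in> J}" and ys: "ys \<in> nlists (n - 1) (carrier L)" for x ys
  proof -
    have "x # ys \<in> nlists n (carrier L)"
      using x ys n_pos by (simp add: Cons_in_nlists_iff)
    moreover have "map proj ys \<in> nlists (n - 1) (carrier Q)"
      using ys unfolding carrier_quotient nlists_image by blast
    ultimately show ?thesis
      using x J_bracket[of "proj x" "map proj ys"] bracket_closed proj_bracket[of "x # ys"] by simp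
  qed
  ultimately show ?thesis
    by (simp add: n_lie_ideal_iff)
qed

end

section \<open>Simple n-Lie Poisson algebras\<close>

context module
begin

text \<open>The sum over the other indices lies in \<open>H\<close>, and subtracting it leaves
  \<open>f j\<close>. This isolates one term on the right of
  \<open>bracket_identity\<close>.\<close>

lemma submodule_finsum_remove:
  assumes H: "submodule H R M" and "finite J" "j \<in> J" and f: "f \<in> J \<rightarrow> carrier M"
    and sum: "(\<Oplus>\<^bsub>M\<^esub>i\<in>J. f i) \<in> H" and rest: "\<And>i. \<lbrakk>i \<in> J; i \<noteq> j\<rbrakk> \<Longrightarrow> f i \<in> H"
  shows "f j \<in> H"
proof -
  have f': "f \<in> (J - {j}) \<rightarrow> carrier M" "f j \<in> carrier M"
    using f assms(3) by auto
  have "(\<Oplus>\<^bsub>M\<^esub>i\<in>J. f i) = (\<Oplus>\<^bsub>M\<^esub>i\<in>insert j (J - {j}). f i)"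
    using assms(3) by (simp add: insert_absorb)
  also have "\<dots> = f j \<oplus>\<^bsub>M\<^esub> (\<Oplus>\<^bsub>M\<^esub>i\<in>J - {j}. f i)"
    using f' assms(2) by (intro M.finsum_insert) auto
  also have "\<dots> = (\<Oplus>\<^bsub>M\<^esub>i\<in>J - {j}. f i) \<oplus>\<^bsub>M\<^esub> f j"
    using f' by (intro M.a_comm M.finsum_closed)
  finally show ?thesis
    using sum submodule_add_iff[OF H submodule_finsum[OF H, of "J - {j}" f] f'(2)] rest by simp
qed

end

locale simple_poisson_algebra_char_zero = cring A + P: simple_unital_n_lie_poisson_algebra n F A
  for A :: "('a, 'b, 'd) n_lie_scheme" (structure)
    and n :: nat
    and F :: "('a, 'c) ring_scheme" +
  assumes n_ge_2: "2 \<le> n" and char_zero: "char_zero F"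
begin

abbreviation B where "B \<equiv> bracket_span F A (replicate n (carrier A))"

abbreviation Z where "Z \<equiv> n_lie_center n A"

lemma Cons1: "\<lbrakk>x \<in> X; ys \<in> nlists (n - 1) X\<rbrakk> \<Longrightarrow> x # ys \<in> nlists n X"
  using n_ge_2 by (simp add: Cons_in_nlists_iff)

lemma Cons2: "\<lbrakk>x \<in> X; zs \<in> nlists (n - 2) X\<rbrakk> \<Longrightarrow> x # zs \<in> nlists (n - 1) X"
  using n_ge_2 by (simp add: Cons_in_nlists_iff numeral_2_eq_2)

lemma nlists_pred_cases:
  assumes "ys \<in> nlists (n - 1) X"
  obtains y zs where "ys = y # zs" "y \<in> X" "zs \<in> nlists (n - 2) X"
proof (cases ys)
  case Nil
  then show ?thesis
    using nlistsE_length[OF assms] n_ge_2 by simp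
next
  case (Cons y zs)
  then show ?thesis
    using that[of y zs] assms by (simp add: Cons_in_nlists_iff numeral_2_eq_2)
qed

text \<open>A positive integer multiple is scaling by the image \<open>c\<close> of the integer in
  \<open>F\<close>, which is invertible in characteristic 0.\<close>

lemma torsion_free:
  assumes a: "a \<in> carrier A" and "[Suc k] \<cdot> a = \<zero>"
  shows "a = \<zero>"
proof -
  have smult: "[m] \<cdot> a = ([m] \<cdot>\<^bsub>F\<^esub> \<one>\<^bsub>F\<^esub>) \<odot> a" for m :: nat
    by (induction m) (use a in \<open>simp_all add: P.smult_l_distr\<close>)
  define c where "c = [Suc k] \<cdot>\<^bsub>F\<^esub> \<one>\<^bsub>F\<^esub>"
  have c: "c \<in> carrier F" "c \<noteq> \<zero>\<^bsub>F\<^esub>"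
    using char_zero unfolding c_def char_zero_def by (blast intro: P.add.nat_pow_closed, blast)
  have "a = (inv\<^bsub>F\<^esub> c \<otimes>\<^bsub>F\<^esub> c) \<odot> a"
  proof -
    have "inv\<^bsub>F\<^esub> c \<otimes>\<^bsub>F\<^esub> c = \<one>\<^bsub>F\<^esub>"
      using c by (simp add: P.field_Units)
    then show ?thesis
      using a by (simp only: P.smult_one)
  qed
  also have "\<dots> = inv\<^bsub>F\<^esub> c \<odot> ([Suc k] \<cdot> a)"
    using a c unfolding smult c_def[symmetric] by (intro P.smult_assoc1) (simp_all add: P.field_Units)
  also have "\<dots> = \<zero>"
    unfolding assms(2) using c by (simp add: P.field_Units)
  finally show ?thesis .
qed

text \<open>As \<open>A\<close> has an identity, scaling by \<open>c\<close> is multiplication by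
  \<open>c \<odot> \<one>\<close>, so an ideal absorbs scalars.\<close>

lemma ideal_submodule:
  assumes "ideal I A"
  shows "submodule I F A"
proof -
  interpret I: ideal I A by fact
  have "c \<odot> x \<in> I" if "c \<in> carrier F" "x \<in> I" for c x
  proof -
    have "c \<odot> x = (c \<odot> \<one>) \<otimes> x"
      using that I.Icarr by (simp add: P.smult_assoc2)
    then show ?thesis
      using that I.I_l_closed by simp
  qed
  then show ?thesis
    using I.Icarr by (intro P.submoduleI) auto
qed

lemma poisson_ideal_trivial:
  assumes "ideal I A" and "\<And>x ys. \<lbrakk>x \<in> I; ys \<in> nlists (n - 1) (carrier A)\<rbrakk> \<Longrightarrow> \<omega> (x # ys) \<in> I"
  shows "I = {\<zero>} \<or> I = carrier A"
  using assms ideal_submodule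
  by (intro P.simple) (simp add: n_lie_poisson_ideal_def P.bracket_span_Cons_subset_iff)

lemma bracket_in_B: "xs \<in> nlists n (carrier A) \<Longrightarrow> \<omega> xs \<in> B"
  unfolding bracket_span_def listset_replicate by (intro hull_inc imageI)

lemma submodule_B: "submodule B F A"
  unfolding bracket_span_def listset_replicate
  by (rule P.submodule_hull) (auto intro: P.bracket_closed)

lemma B_closed: "b \<in> B \<Longrightarrow> b \<in> carrier A"
  using P.submoduleE(1)[OF submodule_B] by blast

lemma nlists_B: "xs \<in> nlists m B \<Longrightarrow> xs \<in> nlists m (carrier A)"
  using nlists_mono[OF P.submoduleE(1)[OF submodule_B]] by blast

lemma B_subset: "\<lbrakk>submodule H F A; \<And>xs. xs \<in> nlists n (carrier A) \<Longrightarrow> \<omega> xs \<in> H\<rbrakk> \<Longrightarrow> B \<subseteq> H"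
  by (simp add: P.bracket_span_subset_iff listset_replicate)

section \<open>Derivations obtained from the slots of the bracket\<close>

lemma derivation_head:
  assumes ys: "ys \<in> nlists (n - 1) (carrier A)"
  shows "derivation A (\<lambda>a. \<omega> (a # ys))"
proof unfold_locales
  fix a assume a: "a \<in> carrier A"
  then show "\<omega> (a # ys) \<in> carrier A"
    using ys by (intro P.bracket_closed Cons1)
  fix b assume b: "b \<in> carrier A"
  show "\<omega> ((a \<oplus> b) # ys) = \<omega> (a # ys) \<oplus> \<omega> (b # ys)"
    using P.bracket_add[of "a # ys" 0 a b] a b ys n_ge_2 Cons1[of a "carrier A" ys] by simp
  show "\<omega> ((a \<otimes> b) # ys) = a \<otimes> \<omega> (b # ys) \<oplus> \<omega> (a # ys) \<otimes> b"
    using P.leibniz a b ys by simp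
qed

text \<open>Swapping slots \<open>0\<close> and \<open>i = Suc j\<close> of
  \<open>a # ys[j := x]\<close> restores the head \<open>x\<close> and puts \<open>a\<close> into
  slot \<open>i\<close>. So the map is the negative of a derivation from
  \<open>derivation_head\<close>.\<close>

lemma derivation_slot:
  assumes xs: "xs \<in> nlists n (carrier A)" and i: "i < n"
  shows "derivation A (\<lambda>a. \<omega> (xs[i := a]))"
proof -
  obtain x ys where x: "x \<in> carrier A" "ys \<in> nlists (n - 1) (carrier A)" "xs = x # ys"
    using xs n_ge_2 by (cases xs) (auto simp: Cons_in_nlists_iff dest: nlistsE_length)
  show ?thesis
  proof (cases i)
    case 0
    then show ?thesis
      using derivation_head[OF x(2)] x(3) by simp
  next
    case (Suc j)
    let ?zs = "ys[j := x]"
    have zs: "?zs \<in> nlists (n - 1) (carrier A)"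
      using x by (intro nlists_update_in_list)
    interpret D: derivation A "\<lambda>a. \<omega> (a # ?zs)"
      by (rule derivation_head[OF zs])
    have eq: "\<omega> (xs[i := a]) = \<ominus> \<omega> (a # ?zs)" if a: "a \<in> carrier A" for a
      using P.bracket_skew[of "a # ?zs" 0 i] Cons1[OF a zs] n_ge_2 i Suc x nlistsE_length[OF x(2)] a
      by simp
    show ?thesis
    proof unfold_locales
      fix a assume a: "a \<in> carrier A"
      show "\<omega> (xs[i := a]) \<in> carrier A"
        using xs a by (intro P.bracket_closed nlists_update_in_list)
      fix b assume b: "b \<in> carrier A"
      show "\<omega> (xs[i := a \<oplus> b]) = \<omega> (xs[i := a]) \<oplus> \<omega> (xs[i := b])"
        using a b by (simp add: eq D.D_add minus_add)
      show "\<omega> (xs[i := a \<otimes> b]) = a \<otimes> \<omega> (xs[i := b]) \<oplus> \<omega> (xs[i := a]) \<otimes> b"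
        using a b by (simp add: eq D.D_mult minus_add l_minus r_minus)
    qed
  qed
qed

lemma derivation_second:
  assumes "x \<in> carrier A" "zs \<in> nlists (n - 2) (carrier A)"
  shows "derivation A (\<lambda>a. \<omega> (x # a # zs))"
  using derivation_slot[of "x # x # zs" 1] Cons1[OF assms(1) Cons2[OF assms]] n_ge_2 by simp

lemma swap2:
  assumes "x \<in> carrier A" "y \<in> carrier A" "zs \<in> nlists (n - 2) (carrier A)"
  shows "\<omega> (y # x # zs) = \<ominus> \<omega> (x # y # zs)"
  using assms n_ge_2 P.bracket_swap2 by blast

lemma bracket_smult_head:
  assumes "c \<in> carrier F" "x \<in> carrier A" "ys \<in> nlists (n - 1) (carrier A)"
  shows "\<omega> (c \<odot> x # ys) = c \<odot> \<omega> (x # ys)"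
  using P.bracket_smult[of "x # ys" 0 c x] Cons1[OF assms(2,3)] n_ge_2 assms by simp

text \<open>Skew-symmetry gives that twice the bracket is zero, and \<open>torsion_free\<close>
  removes the factor 2.\<close>

lemma bracket_self2:
  assumes "x \<in> carrier A" "zs \<in> nlists (n - 2) (carrier A)"
  shows "\<omega> (x # x # zs) = \<zero>"
proof -
  have c: "\<omega> (x # x # zs) \<in> carrier A"
    using assms by (intro P.bracket_closed Cons1 Cons2)
  then have "\<omega> (x # x # zs) \<oplus> \<omega> (x # x # zs) = \<zero>"
    using swap2[OF assms(1,1,2)] by (metis r_neg)
  then show ?thesis
    using torsion_free[OF c, of 1] c by simp
qed

text \<open>By \<open>mult_D_pow_nilpotent\<close> the nilradical is stable under brackets and hence
  a Poisson ideal. If it were all of \<open>A\<close>, then \<open>\<one>\<close> would be nilpotent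
  and \<open>A\<close> would be the zero ring, so it is zero in either case.\<close>

lemma reduced:
  assumes a: "a \<in> carrier A" and "a [^] (k :: nat) = \<zero>"
  shows "a = \<zero>"
proof -
  let ?N = "{a \<in> carrier A. \<exists>k :: nat. a [^] k = \<zero>}"
  have "?N = {\<zero>} \<or> ?N = carrier A"
  proof (rule poisson_ideal_trivial)
    fix x ys assume x: "x \<in> ?N" and ys: "ys \<in> nlists (n - 1) (carrier A)"
    interpret D: derivation A "\<lambda>a. \<omega> (a # ys)"
      by (rule derivation_head[OF ys])
    obtain k :: nat where "x [^] k = \<zero>"
      using x by blast
    then have "x [^] k \<otimes> \<omega> (x # ys) [^] (0 :: nat) = \<zero>"
      by simp
    then have "\<exists>k :: nat. \<omega> (x # ys) [^] k = \<zero>"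
    proof (rule D.mult_D_pow_nilpotent[rotated 2])
      show "x \<in> carrier A"
        using x by blast
    qed (rule torsion_free)
    then show "\<omega> (x # ys) \<in> ?N"
      using x by blast
  qed (rule nilradical_ideal)
  moreover have "carrier A = {\<zero>}" if "?N = carrier A"
  proof -
    have "\<one> \<in> ?N"
      using that by simp
    then have "\<one> = \<zero>"
      by auto
    then show ?thesis
      using one_zeroD by blast
  qed
  moreover have "a \<in> ?N"
    using assms by blast
  ultimately show ?thesis
    by blast
qed

text \<open>For \<open>b \<in> B\<close>, applying \<open>D\<close> to \<open>\<omega> (b \<otimes> z # ys) = b \<otimes> \<omega> (z # ys) \<oplus> \<omega> (b # ys) \<otimes> z\<close> shows
  \<open>D z \<otimes> \<omega> (b # ys) \<in> K\<close>; the elements \<open>\<omega> (b # ys)\<close> generate a nonzero Poisson ideal.\<close>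

lemma derivation_into_ideal:
  assumes "\<not> B \<subseteq> Z" and "ideal K A" and "derivation A D" and DB: "\<And>b. b \<in> B \<Longrightarrow> D b \<in> K"
    and z: "z \<in> carrier A"
  shows "D z \<in> K"
proof -
  interpret K: ideal K A by fact
  interpret D: derivation A D by fact
  define S where "S = {\<omega> (b # ys) | b ys. b \<in> B \<and> ys \<in> nlists (n - 1) (carrier A)}"
  have S_closed: "S \<subseteq> carrier A"
    unfolding S_def using P.bracket_closed[OF Cons1] B_closed by blast
  interpret J: ideal "Idl S" A
    by (rule genideal_ideal[OF S_closed])
  \<comment> \<open>The part of \<open>Idl S\<close> whose brackets with \<open>A\<close> stay in
    \<open>Idl S\<close>. It is an ideal containing \<open>S\<close>, hence equal to
    \<open>Idl S\<close>, and this makes \<open>Idl S\<close> a Poisson ideal.\<close>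
  let ?J' = "{a \<in> Idl S. \<forall>ys \<in> nlists (n - 1) (carrier A). \<omega> (a # ys) \<in> Idl S}"
  have SJ: "S \<subseteq> Idl S"
    by (rule genideal_self[OF S_closed])
  have head: "derivation A (\<lambda>a. \<omega> (a # ys))" if "ys \<in> nlists (n - 1) (carrier A)" for ys
    using that by (rule derivation_head)
  have mult: "a \<otimes> x \<in> ?J'" if a: "a \<in> ?J'" and x: "x \<in> carrier A" for a x
    using that derivation.D_mult[OF head, of _ a x] derivation.D_closed[OF head, of _ x]
    by (auto intro!: J.I_r_closed J.a_closed)
  have "ideal ?J' A"
  proof (rule idealI)
    show "ring A" ..
    show "a \<otimes> x \<in> ?J'" if "a \<in> ?J'" "x \<in> carrier A" for a x
      using mult that .
    then show "x \<otimes> a \<in> ?J'" if "a \<in> ?J'" "x \<in> carrier A" for a x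
      using that J.Icarr m_comm[of x a] by simp
    show "subgroup ?J' (add_monoid A)"
    proof (rule add.subgroupI)
      have "\<zero> \<in> ?J'"
        using derivation.D_zero[OF head] by simp
      then show "?J' \<noteq> {}"
        by blast
    qed (auto simp: derivation.D_minus[OF head] derivation.D_add[OF head])
  qed
  moreover have "S \<subseteq> ?J'"
  proof
    fix x assume xS: "x \<in> S"
    then obtain b ys where x: "x = \<omega> (b # ys)" "b \<in> B" "ys \<in> nlists (n - 1) (carrier A)"
      unfolding S_def by blast
    have bys: "b # ys \<in> nlists n (carrier A)"
      using x B_closed by (intro Cons1)
    have "\<omega> (x # zs) \<in> Idl S" if zs: "zs \<in> nlists (n - 1) (carrier A)" for zs
    proof -
      \<comment> \<open>Every term of the identity has again the shape defining \<open>S\<close>: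
        for \<open>i = 0\<close> the new head is a bracket and thus in \<open>B\<close>, otherwise
        the head is still \<open>b\<close>.\<close>
      have "\<omega> ((b # ys)[i := \<omega> ((b # ys) ! i # zs)]) \<in> S" if i: "i < n" for i
      proof (cases i)
        case 0
        have "\<omega> (b # zs) \<in> B"
          using x zs B_closed by (intro bracket_in_B Cons1)
        then show ?thesis
          using 0 x unfolding S_def by auto
      next
        case (Suc j)
        have "ys[j := \<omega> (ys ! j # zs)] \<in> nlists (n - 1) (carrier A)"
          using x zs i Suc by (intro nlists_update_in_list P.bracket_closed Cons1 nlistsE_nth_in) auto
        then show ?thesis
          using Suc x unfolding S_def by auto
      qed
      then show ?thesis
        unfolding x(1) P.bracket_identity[OF bys zs]
        using SJ by (intro P.submodule_finsum ideal_submodule J.ideal_axioms) auto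
    qed
    then show "x \<in> ?J'"
      using xS SJ by blast
  qed
  ultimately have "Idl S \<subseteq> ?J'"
    by (rule genideal_minimal)
  then have "Idl S = {\<zero>} \<or> Idl S = carrier A"
    by (intro poisson_ideal_trivial J.ideal_axioms) blast
  moreover have "Idl S \<noteq> {\<zero>}"
  proof -
    obtain b ys where "b \<in> B" "ys \<in> nlists (n - 1) (carrier A)" "\<omega> (b # ys) \<noteq> \<zero>"
      using \<open>\<not> B \<subseteq> Z\<close> B_closed unfolding n_lie_center_def by blast
    then have "\<omega> (b # ys) \<in> S"
      unfolding S_def by blast
    then show ?thesis
      using SJ \<open>\<omega> (b # ys) \<noteq> \<zero>\<close> by blast
  qed
  \<comment> \<open>The ideal quotient of \<open>K\<close> by \<open>D z\<close> contains the
    generators \<open>S\<close> of the unit ideal, hence also \<open>\<one>\<close>.\<close>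
  moreover have "Idl S \<subseteq> {a \<in> carrier A. D z \<otimes> a \<in> K}"
  proof (rule genideal_minimal)
    have mult: "a \<otimes> x \<in> {a \<in> carrier A. D z \<otimes> a \<in> K}"
      if "a \<in> {a \<in> carrier A. D z \<otimes> a \<in> K}" "x \<in> carrier A" for a x
      using that z K.I_r_closed[of "D z \<otimes> a" x] by (simp add: m_assoc)
    show "ideal {a \<in> carrier A. D z \<otimes> a \<in> K} A"
    proof (rule idealI)
      show "ring A" ..
      show "a \<otimes> x \<in> {a \<in> carrier A. D z \<otimes> a \<in> K}"
        if "a \<in> {a \<in> carrier A. D z \<otimes> a \<in> K}" "x \<in> carrier A" for a x
        using mult that .
      then show "x \<otimes> a \<in> {a \<in> carrier A. D z \<otimes> a \<in> K}"
        if "a \<in> {a \<in> carrier A. D z \<otimes> a \<in> K}" "x \<in> carrier A" for a x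
        using that m_comm[of x a] by simp
      show "subgroup {a \<in> carrier A. D z \<otimes> a \<in> K} (add_monoid A)"
      proof (rule add.subgroupI)
        have "\<zero> \<in> {a \<in> carrier A. D z \<otimes> a \<in> K}"
          using z by simp
        then show "{a \<in> carrier A. D z \<otimes> a \<in> K} \<noteq> {}"
          by blast
      qed (use z in \<open>auto simp: r_distr r_minus\<close>)
    qed
    show "S \<subseteq> {a \<in> carrier A. D z \<otimes> a \<in> K}"
    proof
      fix x assume xS: "x \<in> S"
      then obtain b ys where x: "x = \<omega> (b # ys)" "b \<in> B" "ys \<in> nlists (n - 1) (carrier A)"
        unfolding S_def by blast
      interpret E: derivation A "\<lambda>a. \<omega> (a # ys)"
        by (rule head[OF x(3)])
      have b: "b \<in> carrier A"
        using B_closed x(2) .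
      have inB: "\<omega> (a # ys) \<in> B" if "a \<in> carrier A" for a
        using that x(3) by (intro bracket_in_B Cons1)
      have D_bz: "D (\<omega> ((b \<otimes> z) # ys)) = b \<otimes> D (\<omega> (z # ys)) \<oplus> D b \<otimes> \<omega> (z # ys)
          \<oplus> (\<omega> (b # ys) \<otimes> D z \<oplus> D (\<omega> (b # ys)) \<otimes> z)"
        using b z by (simp add: E.D_mult D.D_mult D.D_add)
      have expand: "D z \<otimes> p = w \<oplus> \<ominus> (q \<oplus> r) \<oplus> \<ominus> s"
        if "w = q \<oplus> r \<oplus> (p \<otimes> D z \<oplus> s)" "p \<in> carrier A" "q \<in> carrier A" "r \<in> carrier A" "s \<in> carrier A"
        for p q r s w
        unfolding that(1) using that(2-) D.D_closed[OF z] by algebra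
      have "D z \<otimes> \<omega> (b # ys) = D (\<omega> ((b \<otimes> z) # ys))
          \<oplus> \<ominus> (b \<otimes> D (\<omega> (z # ys)) \<oplus> D b \<otimes> \<omega> (z # ys)) \<oplus> \<ominus> (D (\<omega> (b # ys)) \<otimes> z)"
        by (rule expand[OF D_bz]) (use b z in simp_all)
      also have "\<dots> \<in> K"
      proof (intro K.a_closed K.a_inv_closed)
        show "b \<otimes> D (\<omega> (z # ys)) \<in> K"
          using K.I_l_closed[OF DB[OF inB[OF z]] b] .
        show "D b \<otimes> \<omega> (z # ys) \<in> K"
          using K.I_r_closed[OF DB[OF x(2)]] z by simp
        show "D (\<omega> (b # ys)) \<otimes> z \<in> K" "D (\<omega> ((b \<otimes> z) # ys)) \<in> K"
          using K.I_r_closed[OF DB[OF inB[OF b]] z] DB inB b z by simp_all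
      qed
      finally show "x \<in> {a \<in> carrier A. D z \<otimes> a \<in> K}"
        using xS S_closed x(1) by blast
    qed
  qed
  ultimately have "D z \<otimes> \<one> \<in> K"
    by blast
  then show ?thesis
    using z by simp
qed

text \<open>The entries of \<open>ys\<close> are released from \<open>B\<close> one at a time. In
  the auxiliary claim the entries at positions below \<open>j\<close> are arbitrary; the induction
  step lets position \<open>j\<close>, which is slot \<open>Suc j\<close> behind the head
  \<open>t\<close>, run over \<open>B\<close> and passes to all of \<open>A\<close> by
  \<open>derivation_into_ideal\<close>.\<close>

lemma bracket_into_ideal:
  assumes "\<not> B \<subseteq> Z" and "ideal K A" and t: "t \<in> carrier A"
    and *: "\<And>ys. ys \<in> nlists (n - 1) B \<Longrightarrow> \<omega> (t # ys) \<in> K"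
    and ys: "ys \<in> nlists (n - 1) (carrier A)"
  shows "\<omega> (t # ys) \<in> K"
proof -
  have "\<omega> (t # ys) \<in> K"
    if "j \<le> n - 1" "ys \<in> nlists (n - 1) (carrier A)" "\<And>i. \<lbrakk>j \<le> i; i < n - 1\<rbrakk> \<Longrightarrow> ys ! i \<in> B" for j ys
    using that
  proof (induction j arbitrary: ys)
    case 0
    then have "ys \<in> nlists (n - 1) B"
      using nlistsE_length[OF 0(2)] by (auto intro!: nlistsI simp: set_conv_nth)
    then show ?case
      by (rule *)
  next
    case (Suc j)
    have ys: "t # ys \<in> nlists n (carrier A)"
      using t Suc.prems(2) by (rule Cons1)
    have j: "Suc j < n" "j < length ys"
      using Suc.prems(1) nlistsE_length[OF Suc.prems(2)] by simp_all
    have "\<omega> ((t # ys)[Suc j := ys ! j]) \<in> K"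
    proof (rule derivation_into_ideal[OF assms(1,2) derivation_slot[OF ys j(1)]])
      fix b assume b: "b \<in> B"
      have "\<omega> (t # ys[j := b]) \<in> K"
      proof (rule Suc.IH)
        show "ys[j := b] \<in> nlists (n - 1) (carrier A)"
          using b B_closed Suc.prems(2) by (intro nlists_update_in_list)
        show "ys[j := b] ! i \<in> B" if "j \<le> i" "i < n - 1" for i
          using that b j Suc.prems(3)[of i] by (cases "i = j") auto
      qed (use Suc.prems(1) in simp)
      then show "\<omega> ((t # ys)[Suc j := b]) \<in> K"
        by simp
    qed (use Suc.prems(2) j nlistsE_length[OF Suc.prems(2)] in \<open>auto intro: nlistsE_nth_in\<close>)
    then show ?case
      by simp
  qed
  from this[of "n - 1" ys] show ?thesis
    using ys by simp
qed

text \<open>The case of the zero ideal in \<open>bracket_into_ideal\<close>.\<close>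

lemma mem_center_if_bracket_zero:
  assumes "\<not> B \<subseteq> Z" "t \<in> carrier A" "\<And>ys. ys \<in> nlists (n - 1) B \<Longrightarrow> \<omega> (t # ys) = \<zero>"
  shows "t \<in> Z"
  using bracket_into_ideal[OF assms(1) zeroideal assms(2)] assms(2,3) unfolding n_lie_center_def by blast

end

section \<open>Ideals of the derived algebra\<close>

context simple_poisson_algebra_char_zero
begin

lemma derived_n_lie_algebra: "n_lie_algebra n F (A\<lparr>carrier := B\<rparr>)"
  using submodule_B bracket_in_B nlists_B n_ge_2 by (intro P.n_lie_subalgebra) auto

lemma derived_submodule_iff:
  "submodule U F (A\<lparr>carrier := B\<rparr>) \<longleftrightarrow> submodule U F A \<and> U \<subseteq> B"
proof -
  interpret DL: n_lie_algebra n F "A\<lparr>carrier := B\<rparr>"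
    by (rule derived_n_lie_algebra)
  show ?thesis
  proof
    assume U: "submodule U F (A\<lparr>carrier := B\<rparr>)"
    then have UB: "U \<subseteq> B"
      using DL.submoduleE(1)[OF U] by simp
    have smult: "c \<odot> x \<in> U" if "c \<in> carrier F" "x \<in> U" for c x
      using DL.submoduleE(4)[OF U that] by simp
    have "submodule U F A"
    proof (rule P.submoduleI)
      fix x assume x: "x \<in> U"
      then have "x \<in> carrier A"
        using UB B_closed by blast
      \<comment> \<open>The two structures share their scaling, whereas their additive inverses are
        taken over different carriers; negatives are therefore written as multiples by minus
        one.\<close>
      then have "\<ominus> x = (\<ominus>\<^bsub>F\<^esub> \<one>\<^bsub>F\<^esub>) \<odot> x"
        by (simp add: P.smult_l_minus)
      then show "\<ominus> x \<in> U"
        using smult[OF _ x] by simp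
    qed (use UB B_closed smult DL.submodule_zero[OF U] DL.submoduleE(5)[OF U] in auto)
    then show "submodule U F A \<and> U \<subseteq> B"
      using UB by blast
  next
    assume U: "submodule U F A \<and> U \<subseteq> B"
    show "submodule U F (A\<lparr>carrier := B\<rparr>)"
    proof (rule DL.submoduleI)
      fix x assume x: "x \<in> U"
      then have "x \<in> carrier (A\<lparr>carrier := B\<rparr>)" "x \<in> carrier A"
        using U B_closed by auto
      then have "a_inv (A\<lparr>carrier := B\<rparr>) x = (\<ominus>\<^bsub>F\<^esub> \<one>\<^bsub>F\<^esub>) \<odot> x"
        using DL.smult_l_minus[of "\<one>\<^bsub>F\<^esub>" x] by simp
      then show "a_inv (A\<lparr>carrier := B\<rparr>) x \<in> U"
        using P.submoduleE(4)[OF conjunct1[OF U] _ x] by simp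
    qed (use U P.submodule_zero[of U] P.submoduleE(4,5)[of U] in auto)
  qed
qed

end

locale simple_poisson_derived_ideal = simple_poisson_algebra_char_zero A n F
  for A :: "('a, 'b, 'd) n_lie_scheme" (structure)
    and n :: nat
    and F :: "('a, 'c) ring_scheme" +
  fixes U
  assumes U_ideal: "n_lie_ideal n F (A\<lparr>carrier := B\<rparr>) U"
begin

section \<open>The ideal \<open>U\<close> and the subalgebra \<open>T\<close>\<close>

lemma U_submodule: "submodule U F A" and U_subset: "U \<subseteq> B"
  using U_ideal derived_submodule_iff n_lie_algebra.n_lie_ideal_iff[OF derived_n_lie_algebra] by auto

lemma bracket_in_U: "\<lbrakk>xs \<in> nlists n B; i < n; xs ! i \<in> U\<rbrakk> \<Longrightarrow> \<omega> xs \<in> U"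
proof -
  interpret DL: n_lie_algebra n F "A\<lparr>carrier := B\<rparr>"
    by (rule derived_n_lie_algebra)
  show "\<lbrakk>xs \<in> nlists n B; i < n; xs ! i \<in> U\<rbrakk> \<Longrightarrow> \<omega> xs \<in> U"
    using DL.bracket_slot[of U xs i] U_ideal DL.n_lie_ideal_iff[of U] by simp
qed

text \<open>The brackets are taken with all of \<open>A\<close>, while \<open>U\<close> is only
  assumed to absorb brackets with \<open>B\<close>. If \<open>T\<close> is all of \<open>A\<close>,
  then \<open>B \<subseteq> U\<close>.\<close>

definition T where "T = {t \<in> carrier A. \<forall>ys \<in> nlists (n - 1) (carrier A). \<omega> (t # ys) \<in> U}"

lemma T_closed: "t \<in> T \<Longrightarrow> t \<in> carrier A"
  and T_bracket: "\<lbrakk>t \<in> T; ys \<in> nlists (n - 1) (carrier A)\<rbrakk> \<Longrightarrow> \<omega> (t # ys) \<in> U"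
  by (auto simp: T_def)

lemma T_submodule: "submodule T F A"
proof (rule P.submoduleI)
  have head: "derivation A (\<lambda>a. \<omega> (a # ys))" if "ys \<in> nlists (n - 1) (carrier A)" for ys
    using that by (rule derivation_head)
  note D = derivation.D_zero[OF head] derivation.D_minus[OF head] derivation.D_add[OF head]
  show "T \<subseteq> carrier A"
    by (auto simp: T_def)
  show "\<zero> \<in> T"
    using P.submodule_zero[OF U_submodule] by (simp add: T_def D)
  show "\<ominus> a \<in> T" if "a \<in> T" for a
    using that P.submoduleE(6)[OF U_submodule] by (simp add: T_def D)
  show "a \<oplus> b \<in> T" if "a \<in> T" "b \<in> T" for a b
    using that P.submoduleE(5)[OF U_submodule] by (simp add: T_def D)
  show "c \<odot> x \<in> T" if "c \<in> carrier F" "x \<in> T" for c x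
    using that P.submoduleE(4)[OF U_submodule] by (simp add: T_def bracket_smult_head)
qed

text \<open>The Leibniz rule gives \<open>\<omega> ((t \<otimes> s) # y # zs) = \<omega> (t # (s
  \<otimes> y) # zs) \<oplus> \<omega> (s # (t \<otimes> y) # zs)\<close>: the extra terms are the
  multiples of \<open>y\<close> by \<open>\<omega> (t # s # zs)\<close> and by its negative, and
  they cancel.\<close>

lemma T_mult:
  assumes t: "t \<in> T" and s: "s \<in> T"
  shows "t \<otimes> s \<in> T"
proof -
  have ts: "t \<in> carrier A" "s \<in> carrier A"
    using assms T_closed by auto
  have "\<omega> ((t \<otimes> s) # ys) \<in> U" if ys: "ys \<in> nlists (n - 1) (carrier A)" for ys
  proof -
    obtain y zs where y: "ys = y # zs" "y \<in> carrier A" "zs \<in> nlists (n - 2) (carrier A)"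
      using ys by (rule nlists_pred_cases)
    interpret D: derivation A "\<lambda>a. \<omega> (a # ys)"
      by (rule derivation_head[OF ys])
    interpret D1: derivation A "\<lambda>a. \<omega> (t # a # zs)"
      by (rule derivation_second[OF ts(1) y(3)])
    interpret D2: derivation A "\<lambda>a. \<omega> (s # a # zs)"
      by (rule derivation_second[OF ts(2) y(3)])
    have *: "t \<otimes> p \<oplus> q \<otimes> s = (s \<otimes> q \<oplus> r \<otimes> y) \<oplus> (t \<otimes> p \<oplus> (\<ominus> r) \<otimes> y)"
      if "p \<in> carrier A" "q \<in> carrier A" "r \<in> carrier A" for p q r
      using that ts y(2) by algebra
    have "\<omega> ((t \<otimes> s) # ys) = t \<otimes> \<omega> (s # ys) \<oplus> \<omega> (t # ys) \<otimes> s"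
      using ts by (simp add: D.D_mult)
    also have "\<dots> = (s \<otimes> \<omega> (t # ys) \<oplus> \<omega> (t # s # zs) \<otimes> y) \<oplus> (t \<otimes> \<omega> (s # ys) \<oplus> (\<ominus> \<omega> (t # s # zs)) \<otimes> y)"
      using ts by (intro *) simp_all
    also have "\<dots> = \<omega> (t # (s \<otimes> y) # zs) \<oplus> \<omega> (s # (t \<otimes> y) # zs)"
      using ts y swap2[OF ts y(3)] by (simp add: D1.D_mult D2.D_mult)
    finally show ?thesis
      using T_bracket[OF t Cons2, of "s \<otimes> y" zs] T_bracket[OF s Cons2, of "t \<otimes> y" zs] ts y
        P.submoduleE(5)[OF U_submodule] by simp
  qed
  then show ?thesis
    using ts by (simp add: T_def)
qed

text \<open>Expand \<open>\<omega> (\<omega> (t # ys) # vs)\<close>, which lies in \<open>U\<close>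
  because \<open>U\<close> is an ideal of the derived algebra. In all terms except the one for slot
  \<open>0\<close> the head is still \<open>t\<close>, so they lie in \<open>U\<close>, and the
  remaining term \<open>\<omega> (\<omega> (t # vs) # ys)\<close> does too.\<close>

lemma bracket_T_B:
  assumes t: "t \<in> T" and vs: "vs \<in> nlists (n - 1) B"
  shows "\<omega> (t # vs) \<in> T"
proof -
  have "\<omega> (\<omega> (t # vs) # ys) \<in> U" if ys: "ys \<in> nlists (n - 1) (carrier A)" for ys
  proof -
    let ?f = "\<lambda>i. \<omega> ((t # ys)[i := \<omega> ((t # ys) ! i # vs)])"
    have tys: "t # ys \<in> nlists n (carrier A)"
      using T_closed[OF t] ys by (rule Cons1)
    have "?f 0 \<in> U"
    proof (rule P.submodule_finsum_remove[OF U_submodule, of "{..<n}"])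
      have "\<omega> (t # ys) # vs \<in> nlists n B"
        by (rule Cons1[OF bracket_in_B[OF tys] vs])
      then have "\<omega> (\<omega> (t # ys) # vs) \<in> U"
        using bracket_in_U[of _ 0] T_bracket[OF t ys] n_ge_2 by simp
      then show "(\<Oplus>i\<in>{..<n}. ?f i) \<in> U"
        by (simp add: P.bracket_identity[OF tys nlists_B[OF vs]])
      show "?f \<in> {..<n} \<rightarrow> carrier A"
        using P.bracket_closed[OF nlists_update_in_list[OF tys
            P.bracket_closed[OF Cons1[OF nlistsE_nth_in[OF tys] nlists_B[OF vs]]]]]
        by blast
      show "?f i \<in> U" if i: "i \<in> {..<n}" "i \<noteq> 0" for i
      proof -
        obtain j where j: "i = Suc j"
          using i(2) by (cases i) auto
        have "ys[j := \<omega> (ys ! j # vs)] \<in> nlists (n - 1) (carrier A)"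
          using ys i j nlists_B[OF vs]
          by (intro nlists_update_in_list P.bracket_closed Cons1 nlistsE_nth_in) auto
        then show ?thesis
          using T_bracket[OF t] j by simp
      qed
    qed (use n_ge_2 in auto)
    then show ?thesis
      by simp
  qed
  then show ?thesis
    using T_closed[OF t] nlists_B[OF vs] by (simp add: T_def P.bracket_closed Cons1)
qed

text \<open>Each term of the n-Lie identity alters one slot and puts an element of \<open>B\<close>
  there. Two slots carry entries from \<open>U\<close>, so at least one of them survives.\<close>

lemma bracket_U_U_B:
  assumes u: "u \<in> U" "v \<in> U" and zs: "zs \<in> nlists (n - 2) B"
  shows "\<omega> (u # v # zs) \<in> T"
proof -
  let ?xs = "u # v # zs"
  have xs: "?xs \<in> nlists n B"
    using u U_subset zs by (intro Cons1 Cons2) auto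
  have "\<omega> (\<omega> ?xs # ys) \<in> U" if ys: "ys \<in> nlists (n - 1) (carrier A)" for ys
  proof -
    have "\<omega> (?xs[i := \<omega> (?xs ! i # ys)]) \<in> U" if i: "i < n" for i
    proof -
      have "?xs[i := \<omega> (?xs ! i # ys)] \<in> nlists n B"
        by (rule nlists_update_in_list[OF xs bracket_in_B[OF Cons1[OF nlistsE_nth_in[OF nlists_B[OF xs] i] ys]]])
      moreover have "?xs[i := \<omega> (?xs ! i # ys)] ! (if i = 0 then 1 else 0) \<in> U"
        using u by (cases i) simp_all
      ultimately show ?thesis
        using n_ge_2 by (intro bracket_in_U[of _ "if i = 0 then 1 else 0"]) auto
    qed
    then show ?thesis
      unfolding P.bracket_identity[OF nlists_B[OF xs] ys]
      by (intro P.submodule_finsum[OF U_submodule]) auto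
  qed
  then show ?thesis
    using P.bracket_closed[OF nlists_B[OF xs]] by (simp add: T_def)
qed

lemma bracket_Cons2_in_B:
  "\<lbrakk>x \<in> carrier A; y \<in> carrier A; zs \<in> nlists (n - 2) B\<rbrakk> \<Longrightarrow> \<omega> (x # y # zs) \<in> B"
  using nlists_B by (intro bracket_in_B Cons1 Cons2)

text \<open>For \<open>D = \<omega> (t # _ # zs)\<close>, a vanishing \<open>D \<circ> D\<close> on
  \<open>B\<close> makes \<open>D\<close> vanish on \<open>B\<close>. This is
  \<open>D_cube_eq_zero\<close> with \<open>v = b\<close> and
  \<open>E = \<omega> (b # _ # zs)\<close>, whose values lie in \<open>B\<close>, followed by
  reducedness.\<close>

lemma bracket_zero_if_double_bracket_zero:
  assumes t: "t \<in> carrier A" and zs: "zs \<in> nlists (n - 2) B"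
    and "\<And>b. b \<in> B \<Longrightarrow> \<omega> (t # \<omega> (t # b # zs) # zs) = \<zero>" and b: "b \<in> B"
  shows "\<omega> (t # b # zs) = \<zero>"
proof -
  have zs': "zs \<in> nlists (n - 2) (carrier A)"
    using zs by (rule nlists_B)
  interpret D: derivation A "\<lambda>a. \<omega> (t # a # zs)"
    by (rule derivation_second[OF t zs'])
  have "\<omega> (t # b # zs) [^] (3 :: nat) = \<zero>"
  proof (rule D.D_cube_eq_zero[OF torsion_free derivation_second[OF B_closed[OF b] zs'] B_closed[OF b] t])
    show "\<omega> (b # b # zs) = \<zero>"
      using bracket_self2 B_closed b zs' by blast
    show "\<omega> (b # t # zs) = \<ominus> \<omega> (t # b # zs)"
      using swap2 t B_closed[OF b] zs' by blast
  qed (use assms bracket_Cons2_in_B B_closed in auto)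
  then show ?thesis
    using reduced[of "\<omega> (t # b # zs)" 3] D.D_closed[OF B_closed[OF b]] by blast
qed

text \<open>Let \<open>D = \<omega> (u # _ # zs)\<close> with \<open>zs\<close> over
  \<open>B\<close>. For \<open>a \<in> B\<close> the element \<open>D (D a)\<close> is a bracket of
  \<open>u\<close> and \<open>D a\<close>, both in \<open>U\<close>, so it lies in \<open>T\<close>
  and is central; hence \<open>D\<close> kills it. Then \<open>D_D_pow4_eq_zero\<close> and
  reducedness make \<open>D \<circ> D\<close> vanish on \<open>B\<close>, and the preceding lemma
  makes \<open>D\<close> vanish there.\<close>

lemma U_central:
  assumes "\<not> B \<subseteq> Z" "T \<subseteq> Z"
  shows "U \<subseteq> Z"
proof
  fix u assume u: "u \<in> U"
  then have uB: "u \<in> B"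
    using U_subset by blast
  then have uA: "u \<in> carrier A"
    by (rule B_closed)
  have "\<omega> (u # b # zs) = \<zero>" if zs: "zs \<in> nlists (n - 2) B" and "b \<in> B" for b zs
    using uA zs _ \<open>b \<in> B\<close>
  proof (rule bracket_zero_if_double_bracket_zero)
    fix b assume b: "b \<in> B"
    have zs': "zs \<in> nlists (n - 2) (carrier A)"
      using zs by (rule nlists_B)
    interpret D: derivation A "\<lambda>a. \<omega> (u # a # zs)"
      by (rule derivation_second[OF uA zs'])
    have in_U: "\<omega> (u # a # zs) \<in> U" if "a \<in> B" for a
      using u uB that zs n_ge_2 by (intro bracket_in_U[of _ 0] Cons1 Cons2) auto
    have cube: "\<omega> (u # \<omega> (u # \<omega> (u # a # zs) # zs) # zs) = \<zero>" if a: "a \<in> B" for a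
    proof -
      let ?d = "\<omega> (u # \<omega> (u # a # zs) # zs)"
      have "?d \<in> Z"
        using bracket_U_U_B[OF u in_U[OF a] zs] \<open>T \<subseteq> Z\<close> by blast
      then have "?d \<in> carrier A" "\<omega> (?d # u # zs) = \<zero>"
        using Cons2[OF uA zs'] by (auto simp: n_lie_center_def)
      then show ?thesis
        using swap2[OF _ uA zs', of ?d] by simp
    qed
    have "\<omega> (u # \<omega> (u # b # zs) # zs) [^] (4 :: nat) = \<zero>"
    proof (rule D.D_D_pow4_eq_zero[OF torsion_free derivation_second[OF B_closed[OF b] zs'] B_closed[OF b] uA])
      show "\<omega> (b # b # zs) = \<zero>"
        using bracket_self2 B_closed b zs' by blast
      show "\<omega> (b # u # zs) = \<ominus> \<omega> (u # b # zs)"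
        using swap2 uA B_closed[OF b] zs' by blast
    qed (use b zs cube bracket_Cons2_in_B B_closed in auto)
    then show "\<omega> (u # \<omega> (u # b # zs) # zs) = \<zero>"
      using reduced[of "\<omega> (u # \<omega> (u # b # zs) # zs)" 4] B_closed[OF b] D.D_closed by blast
  qed
  then have "\<omega> (u # ys) = \<zero>" if "ys \<in> nlists (n - 1) B" for ys
    using nlists_pred_cases[OF that] by metis
  then show "u \<in> Z"
    by (rule mem_center_if_bracket_zero[OF assms(1) uA])
qed

section \<open>The largest ideal of \<open>A\<close> inside \<open>T\<close>\<close>

definition K where "K = {k \<in> carrier A. \<forall>a \<in> carrier A. k \<otimes> a \<in> T}"

lemma K_ideal: "ideal K A"
proof (rule idealI)
  show "ring A" ..
  show mult: "a \<otimes> x \<in> K" if "a \<in> K" "x \<in> carrier A" for a x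
    using that by (auto simp: K_def m_assoc)
  show "x \<otimes> a \<in> K" if "a \<in> K" "x \<in> carrier A" for a x
    using mult[OF that] that m_comm[of x a] by (simp add: K_def)
  show "subgroup K (add_monoid A)"
  proof (rule add.subgroupI)
    have "\<zero> \<in> K"
      using P.submodule_zero[OF T_submodule] by (simp add: K_def)
    then show "K \<noteq> {}"
      by blast
  qed (use P.submoduleE(5,6)[OF T_submodule] in \<open>auto simp: K_def l_distr l_minus\<close>)
qed

text \<open>For \<open>vs\<close> over \<open>B\<close>, the product
  \<open>\<omega> (k # vs) \<otimes> a\<close> is the difference of
  \<open>\<omega> ((k \<otimes> a) # vs)\<close> and \<open>k \<otimes> \<omega> (a # vs)\<close>,
  both in \<open>T\<close>. So \<open>K\<close> is stable under brackets with \<open>B\<close>, by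
  \<open>bracket_into_ideal\<close> under brackets with \<open>A\<close>, and simplicity
  applies.\<close>

lemma K_eq_carrier:
  assumes "\<not> B \<subseteq> Z" "K \<noteq> {\<zero>}"
  shows "K = carrier A"
proof -
  have "\<omega> (k # ys) \<in> K" if k: "k \<in> K" and ys: "ys \<in> nlists (n - 1) (carrier A)" for k ys
  proof (rule bracket_into_ideal[OF assms(1) K_ideal _ _ ys])
    show kA: "k \<in> carrier A"
      using k by (simp add: K_def)
    fix vs assume vs: "vs \<in> nlists (n - 1) B"
    interpret D: derivation A "\<lambda>a. \<omega> (a # vs)"
      by (rule derivation_head[OF nlists_B[OF vs]])
    have "\<omega> (k # vs) \<otimes> a \<in> T" if a: "a \<in> carrier A" for a
    proof -
      have "\<omega> ((k \<otimes> a) # vs) \<in> T" "k \<otimes> \<omega> (a # vs) \<in> T"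
        using k a vs by (auto simp: K_def intro!: bracket_T_B)
      moreover have "\<omega> ((k \<otimes> a) # vs) = k \<otimes> \<omega> (a # vs) \<oplus> \<omega> (k # vs) \<otimes> a"
        using kA a by (simp add: D.D_mult)
      ultimately show ?thesis
        using P.submodule_add_iff[OF T_submodule, of "k \<otimes> \<omega> (a # vs)" "\<omega> (k # vs) \<otimes> a"] kA a by simp
    qed
    then show "\<omega> (k # vs) \<in> K"
      using kA by (simp add: K_def)
  qed
  then show ?thesis
    using poisson_ideal_trivial[OF K_ideal] assms(2) by blast
qed

text \<open>With \<open>f = \<omega> (t # x # zs)\<close>, the derivation \<open>E y = f \<otimes> \<omega> (x # y # zs)\<close> maps \<open>A\<close> into \<open>T\<close>,
  so that \<open>f \<otimes> f \<otimes> w = t \<otimes> E w \<ominus> E (t \<otimes> w)\<close> is in \<open>T\<close>.\<close>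

lemma bracket_square_in_K:
  assumes t: "t \<in> T" and x: "x \<in> T" and zs: "zs \<in> nlists (n - 2) B"
  shows "\<omega> (t # x # zs) \<otimes> \<omega> (t # x # zs) \<in> K"
proof -
  have zs': "zs \<in> nlists (n - 2) (carrier A)"
    using zs by (rule nlists_B)
  have tx: "t \<in> carrier A" "x \<in> carrier A"
    using t x T_closed by auto
  interpret D: derivation A "\<lambda>a. \<omega> (t # a # zs)"
    by (rule derivation_second[OF tx(1) zs'])
  interpret E: derivation A "\<lambda>a. \<omega> (x # a # zs)"
    by (rule derivation_second[OF tx(2) zs'])
  define f where "f = \<omega> (t # x # zs)"
  have f: "f \<in> carrier A"
    using tx by (simp add: f_def)
  have fE: "f \<otimes> \<omega> (x # y # zs) \<in> T" if y: "y \<in> carrier A" for y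
  proof -
    let ?g = "\<omega> (x # y # zs)"
    \<comment> \<open>Since \<open>\<omega> (x # x # zs) = \<zero>\<close>, the product
      \<open>x \<otimes> ?g\<close> is itself a bracket and lies in \<open>B\<close>. Hence its
      bracket with \<open>t\<close> is in \<open>T\<close>, and removing the product
      \<open>x \<otimes> \<omega> (t # ?g # zs)\<close> of two elements of \<open>T\<close> leaves
      \<open>f \<otimes> ?g\<close>.\<close>
    have "x \<otimes> ?g = \<omega> (x # (x \<otimes> y) # zs)"
      using tx y bracket_self2[OF tx(2) zs'] by (simp add: E.D_mult)
    then have "x \<otimes> ?g \<in> B" "?g \<in> B"
      using bracket_Cons2_in_B[OF tx(2) _ zs] tx y by simp_all
    then have "\<omega> (t # (x \<otimes> ?g) # zs) \<in> T" "x \<otimes> \<omega> (t # ?g # zs) \<in> T"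
      using t x zs by (auto intro!: bracket_T_B T_mult Cons2)
    moreover have "\<omega> (t # (x \<otimes> ?g) # zs) = x \<otimes> \<omega> (t # ?g # zs) \<oplus> f \<otimes> ?g"
      using tx y by (simp add: D.D_mult f_def)
    ultimately show ?thesis
      using P.submodule_add_iff[OF T_submodule, of "x \<otimes> \<omega> (t # ?g # zs)" "f \<otimes> ?g"] tx y f by simp
  qed
  have "f \<otimes> f \<otimes> w \<in> T" if w: "w \<in> carrier A" for w
  proof -
    have *: "f \<otimes> f \<otimes> w = t \<otimes> (f \<otimes> p) \<oplus> \<ominus> (f \<otimes> (t \<otimes> p \<oplus> (\<ominus> f) \<otimes> w))" if "p \<in> carrier A" for p
      using that f tx w by algebra
    have "\<omega> (x # (t \<otimes> w) # zs) = t \<otimes> \<omega> (x # w # zs) \<oplus> (\<ominus> f) \<otimes> w"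
      using tx w swap2[OF tx zs'] by (simp add: E.D_mult f_def)
    then have "f \<otimes> f \<otimes> w = t \<otimes> (f \<otimes> \<omega> (x # w # zs)) \<oplus> \<ominus> (f \<otimes> \<omega> (x # (t \<otimes> w) # zs))"
      using *[of "\<omega> (x # w # zs)"] w by simp
    also have "\<dots> \<in> T"
      using T_mult[OF t fE[OF w]] fE[OF m_closed[OF tx(1) w]]
      by (intro P.submoduleE(5,6)[OF T_submodule])
    finally show ?thesis .
  qed
  then show ?thesis
    using f by (simp add: K_def f_def)
qed

theorem U_central_or_eq_B: "U \<subseteq> Z \<or> U = B"
proof (cases "B \<subseteq> Z \<or> T \<subseteq> Z")
  case True
  then show ?thesis
    using U_subset U_central by blast
next
  case False
  then obtain t where t: "t \<in> T" "t \<notin> Z"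
    by blast
  have tA: "t \<in> carrier A"
    using t(1) by (rule T_closed)
  have "\<exists>vs \<in> nlists (n - 1) B. \<omega> (t # vs) \<noteq> \<zero>"
    using mem_center_if_bracket_zero[of t] False t(2) tA by blast
  then obtain v zs where v: "v \<in> B" "zs \<in> nlists (n - 2) B" "\<omega> (t # v # zs) \<noteq> \<zero>"
    by (metis nlists_pred_cases)
  \<comment> \<open>If the double bracket with \<open>t\<close> vanished on \<open>B\<close>, so
    would the single one, contrary to the choice of \<open>v\<close>. The inner bracket with
    \<open>b\<close> is again in \<open>T\<close>, so it can serve as \<open>x\<close> in
    \<open>bracket_square_in_K\<close>.\<close>
  then obtain b where b: "b \<in> B" "\<omega> (t # \<omega> (t # b # zs) # zs) \<noteq> \<zero>"
    using bracket_zero_if_double_bracket_zero[OF tA v(2)] by blast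
  let ?f = "\<omega> (t # \<omega> (t # b # zs) # zs)"
  have x: "\<omega> (t # b # zs) \<in> T"
    using t(1) b(1) v(2) by (intro bracket_T_B Cons2)
  have f: "?f \<in> carrier A"
    by (rule P.bracket_closed[OF Cons1[OF tA Cons2[OF T_closed[OF x] nlists_B[OF v(2)]]]])
  have "?f \<otimes> ?f \<in> K"
    using t(1) x v(2) by (rule bracket_square_in_K)
  moreover have "?f \<otimes> ?f \<noteq> \<zero>"
    using reduced[OF f, of 2] b(2) f by (auto simp: numeral_2_eq_2)
  ultimately have "K = carrier A"
    using False by (intro K_eq_carrier) auto
  then have "a \<in> T" if "a \<in> carrier A" for a
  proof -
    have "a \<otimes> \<one> \<in> T"
      using that \<open>K = carrier A\<close> unfolding K_def by blast
    then show ?thesis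
      using that by simp
  qed
  then have "\<omega> xs \<in> U" if "xs \<in> nlists n (carrier A)" for xs
    using that T_bracket n_ge_2
    by (cases xs) (auto simp: Cons_in_nlists_iff dest: nlistsE_length)
  then show ?thesis
    using B_subset[OF U_submodule] U_subset by blast
qed

end

section \<open>Simplicity of the quotient by the center\<close>

context simple_poisson_algebra_char_zero
begin

lemma center_ideal: "n_lie_ideal n F (A\<lparr>carrier := B\<rparr>) (B \<inter> Z)"
proof -
  interpret DL: n_lie_algebra n F "A\<lparr>carrier := B\<rparr>"
    by (rule derived_n_lie_algebra)
  have "submodule (B \<inter> Z) F A"
  proof (rule P.submoduleI)
    have head: "derivation A (\<lambda>a. \<omega> (a # ys))" if "ys \<in> nlists (n - 1) (carrier A)" for ys
      using that by (rule derivation_head)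
    note D = derivation.D_zero[OF head] derivation.D_minus[OF head] derivation.D_add[OF head]
    show "\<zero> \<in> B \<inter> Z"
      using P.submodule_zero[OF submodule_B] by (simp add: n_lie_center_def D)
    show "\<ominus> a \<in> B \<inter> Z" if "a \<in> B \<inter> Z" for a
      using that P.submoduleE(6)[OF submodule_B] by (simp add: n_lie_center_def D)
    show "a \<oplus> b \<in> B \<inter> Z" if "a \<in> B \<inter> Z" "b \<in> B \<inter> Z" for a b
      using that P.submoduleE(5)[OF submodule_B] by (simp add: n_lie_center_def D)
    show "c \<odot> x \<in> B \<inter> Z" if "c \<in> carrier F" "x \<in> B \<inter> Z" for c x
      using that P.submoduleE(4)[OF submodule_B]
      by (simp add: n_lie_center_def bracket_smult_head)
  qed (auto simp: n_lie_center_def)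
  moreover have "\<omega> (x # ys) \<in> B \<inter> Z" if "x \<in> B \<inter> Z" "ys \<in> nlists (n - 1) B" for x ys
  proof -
    have "\<omega> (x # ys) = \<zero>"
      using that nlists_B by (auto simp: n_lie_center_def)
    then show ?thesis
      using P.submodule_zero[OF calculation] by simp
  qed
  ultimately show ?thesis
    by (simp add: DL.n_lie_ideal_iff derived_submodule_iff)
qed

text \<open>An ideal \<open>J\<close> of the quotient is the image of its preimage
  \<open>?U\<close>, an ideal of the derived algebra. If \<open>?U\<close> is central it projects to
  zero, and if it is \<open>B\<close> it projects onto everything.\<close>

theorem derived_mod_center_simple:
  "simple_n_lie_algebra n F (n_lie_quotient (A\<lparr>carrier := B\<rparr>) (B \<inter> Z))"
proof -
  let ?L = "A\<lparr>carrier := B\<rparr>"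
  interpret QI: n_lie_algebra_ideal n F ?L "B \<inter> Z"
    using derived_n_lie_algebra center_ideal n_ge_2
    by (intro n_lie_algebra_ideal.intro n_lie_algebra_ideal_axioms.intro) auto
  interpret Q: n_lie_algebra n F QI.Q
    by (rule QI.quotient_n_lie_algebra)
  show ?thesis
  proof (intro simple_n_lie_algebra.intro simple_n_lie_algebra_axioms.intro)
    fix J assume J: "n_lie_ideal n F QI.Q J"
    let ?U = "{x \<in> carrier ?L. QI.proj x \<in> J}"
    have J_sub: "submodule J F QI.Q"
      using J by (simp add: Q.n_lie_ideal_iff)
    have J_eq: "J = QI.proj ` ?U"
      using QI.Q.submoduleE(1)[OF J_sub] unfolding QI.carrier_quotient by blast
    interpret simple_poisson_derived_ideal A n F ?U
      using QI.quotient_ideal_preimage[OF J]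
      by (intro simple_poisson_derived_ideal.intro simple_poisson_derived_ideal_axioms.intro
          simple_poisson_algebra_char_zero_axioms)
    from U_central_or_eq_B show "J = {\<zero>\<^bsub>QI.Q\<^esub>} \<or> J = carrier QI.Q"
    proof
      assume "?U \<subseteq> Z"
      then have "QI.proj x = \<zero>\<^bsub>QI.Q\<^esub>" if "x \<in> ?U" for x
        using that QI.proj_eq_zero_iff[of x] by auto
      then have "J \<subseteq> {\<zero>\<^bsub>QI.Q\<^esub>}"
        using J_eq by blast
      then show ?thesis
        using QI.Q.submodule_zero[OF J_sub] by blast
    next
      assume "?U = B"
      then have "QI.proj ` ?U = carrier QI.Q"
        using QI.carrier_quotient by simp
      then have "J = carrier QI.Q"
        by (rule trans[OF J_eq])
      then show ?thesis ..
    qed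
  qed (rule QI.quotient_n_lie_algebra)
qed

end

theorem theorem1p1:
  fixes n :: nat
    and F :: "('a, 'c) ring_scheme"
    and A :: "('a, 'b, 'd) n_lie_scheme"
  assumes "n \<ge> 2"
    and "field F"
    and "char_zero F"
    and "simple_unital_n_lie_poisson_algebra n F A"
  shows "simple_n_lie_algebra n F
    (n_lie_quotient (n_lie_derived n F A) (carrier (n_lie_derived n F A) \<inter> n_lie_center n A))"
proof -
  interpret P: simple_unital_n_lie_poisson_algebra n F A by fact
  interpret simple_poisson_algebra_char_zero A n F
    using assms P.M_cring
    by (intro simple_poisson_algebra_char_zero.intro simple_poisson_algebra_char_zero_axioms.intro)
  show ?thesis
    using derived_mod_center_simple by (simp add: n_lie_derived_def)
qed

end
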